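(* Let $n\ge1$, let $d$ be a positive even integer, and let $K=\{x\in\mathbb{R}^n: w_j(x)\ge0,\ j=1,\ldots,s\}$, with $w_1,\ldots,w_s\in\mathbb{R}[x]$, be compact with nonempty interior. Assume that there exist $M>0$ and $k\in\mathbb{N}$ such that the quadratic polynomial $x\mapsto M-\|x\|^2$ belongs to $\mathcal{C}_k$. Let $\rho$ be the optimal value of $$\mathcal{P}:\qquad \rho=\inf_{g\in H[x]_d}\left\{\int_{\mathbb{R}^n}\exp(-g(x))\,dx\;:\;1-g\in C_d(K)\right\},$$ and for $k\in\mathbb{N}$ let $\rho_k$ be the optimal value of $$\mathcal{P}_k:\qquad \rho_k=\inf_{g,\sigma_j}\left\{\int_{\mathbb{R}^n}\exp(-g(x))\,dx\;:\;1-g=\sum_{j=0}^s\sigma_jw_j,\ g\in\mathbb{R}[x]_d,\ g_\alpha=0\ \ \forall\,|\alpha|<d,\ \sigma_j\in\Sigma_{k-v_j},\ j=0,\ldots,s\right\}.$$ Then $\rho=\lim_{k\to\infty}\rho_k$. Moreover, let $k_0$ be such that for every $k\ge k_0$ problem $\mathcal{P}_k$ has a unique optimal solution $g_k^*\in P[x]_d$ (such a $k_0$ exists). Then, as $k\to\infty$, $g_k^*\to g^*$, where $g^*\in P[x]_d$ is the unique optimal solution of $\mathcal{P}$ (which exists).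
   Context: $\mathbb{R}[x]_d$ is the space of real polynomials in $x=(x_1,\ldots,x_n)$ of degree at most $d$, $g(x)=\sum_\alpha g_\alpha x^\alpha$, $|\alpha|=\sum_i\alpha_i$. $H[x]_d$ is the space of homogeneous polynomials of degree $d$ (including $0$), and $P[x]_d\subset H[x]_d$ is the set of those $g$ whose sublevel set $\{x: g(x)\le1\}$ has finite Lebesgue volume. $C_d(K)$ is the convex cone of polynomials of degree at most $d$ nonnegative on $K$. $\Sigma_k\subset\mathbb{R}[x]_{2k}$ is the convex cone of sums of squares of polynomials, of degree at most $2k$ (with $\Sigma_k=\{0\}$ for $k<0$). $w_0$ is the constant polynomial $1$, $v_j:=\lceil\deg(w_j)/2\rceil$ for $j=0,\ldots,s$, and $$\mathcal{C}_k:=\left\{\sum_{j=0}^s\sigma_jw_j\;:\;\sigma_j\in\Sigma_{k-v_j},\ j=0,1,\ldots,s\right\}.$$ Uniqueness of the optimal solution of $\mathcal{P}_k$ refers to $g$ only (not to the representation $(\sigma_j)$). Convergence $g_k^*\to g^*$ is convergence of coefficient vectors. The infimum over an empty feasible set is $+\infty$. *)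

theory Defs
  imports "HOL-Analysis.Analysis" "HOL-Library.Poly_Mapping"
begin

text \<open>The ring of real polynomials in the variables \<open>x\<^sub>i\<close>, \<open>i :: 'n\<close>: finitely supported
  coefficient families on exponent vectors, with the convolution product of
  \<^theory>\<open>HOL-Library.Poly_Mapping\<close>.\<close>

type_synonym 'n rpoly = "('n \<Rightarrow>\<^sub>0 nat) \<Rightarrow>\<^sub>0 real"

abbreviation mcoeff :: "'n rpoly \<Rightarrow> ('n \<Rightarrow>\<^sub>0 nat) \<Rightarrow> real" where
  "mcoeff \<equiv> Poly_Mapping.lookup"

definition exp_deg :: "('n::finite \<Rightarrow>\<^sub>0 nat) \<Rightarrow> nat" where
  "exp_deg \<alpha> = (\<Sum>i\<in>UNIV. Poly_Mapping.lookup \<alpha> i)"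

definition eval_poly :: "'n::finite rpoly \<Rightarrow> real ^ 'n \<Rightarrow> real" where
  "eval_poly p x =
     (\<Sum>\<alpha>\<in>Poly_Mapping.keys p. mcoeff p \<alpha> * (\<Prod>i\<in>UNIV. x $ i ^ Poly_Mapping.lookup \<alpha> i))"

text \<open>The zero polynomial gets degree 0; as the degree only restricts the multipliers of
  the \<open>w\<^sub>j\<close>, the choice has no effect on \<open>sos_cone\<close> below.\<close>

definition poly_deg :: "'n::finite rpoly \<Rightarrow> nat" where
  "poly_deg p = Max (insert 0 (exp_deg ` Poly_Mapping.keys p))"

definition polys_upto :: "nat \<Rightarrow> 'n::finite rpoly set" where
  "polys_upto d = {p. \<forall>\<alpha>. mcoeff p \<alpha> \<noteq> 0 \<longrightarrow> exp_deg \<alpha> \<le> d}"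

definition homog_polys :: "nat \<Rightarrow> 'n::finite rpoly set" where
  "homog_polys d = {p. \<forall>\<alpha>. mcoeff p \<alpha> \<noteq> 0 \<longrightarrow> exp_deg \<alpha> = d}"

definition finite_vol_homog :: "nat \<Rightarrow> 'n::finite rpoly set" where
  "finite_vol_homog d =
     {g \<in> homog_polys d. emeasure lborel {x. eval_poly g x \<le> 1} < \<infinity>}"

definition nonneg_cone :: "nat \<Rightarrow> (real ^ 'n::finite) set \<Rightarrow> 'n rpoly set" where
  "nonneg_cone d K = {p \<in> polys_upto d. \<forall>x\<in>K. 0 \<le> eval_poly p x}"

definition sos :: "int \<Rightarrow> 'n::finite rpoly set" where
  "sos k = (if k < 0 then {0}
     else {\<sigma> \<in> polys_upto (2 * nat k). \<exists>(m::nat) q. \<sigma> = (\<Sum>i<m. (q i)\<^sup>2)})"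

definition half_deg :: "'n::finite rpoly \<Rightarrow> int" where
  "half_deg p = \<lceil>real (poly_deg p) / 2\<rceil>"

definition sos_cone :: "(nat \<Rightarrow> 'n::finite rpoly) \<Rightarrow> nat \<Rightarrow> nat \<Rightarrow> 'n rpoly set" where
  "sos_cone w s k =
     {(\<Sum>j=0..s. \<sigma> j * w j) | \<sigma>. \<forall>j\<in>{0..s}. \<sigma> j \<in> sos (int k - half_deg (w j))}"

definition ball_poly :: "real \<Rightarrow> 'n::finite rpoly" where
  "ball_poly M = Poly_Mapping.single 0 M
     - (\<Sum>i\<in>UNIV. (Poly_Mapping.single (Poly_Mapping.single i 1) 1)\<^sup>2)"

text \<open>The objective takes the value \<open>\<infinity>\<close> when the integral diverges, and the infimum over
  an empty feasible set is \<open>\<infinity>\<close>.\<close>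

definition objective :: "'n::finite rpoly \<Rightarrow> ennreal" where
  "objective g = (\<integral>\<^sup>+x. ennreal (exp (- eval_poly g x)) \<partial>lborel)"

definition opt_value :: "'n::finite rpoly set \<Rightarrow> ennreal" where
  "opt_value S = (INF g\<in>S. objective g)"

definition unique_optimal :: "'n::finite rpoly set \<Rightarrow> 'n rpoly \<Rightarrow> bool" where
  "unique_optimal S g \<longleftrightarrow>
     is_arg_min objective (\<lambda>h. h \<in> S) g \<and> (\<forall>h. is_arg_min objective (\<lambda>h. h \<in> S) h \<longrightarrow> h = g)"

definition feasible :: "nat \<Rightarrow> (real ^ 'n::finite) set \<Rightarrow> 'n rpoly set" where
  "feasible d K = {g \<in> homog_polys d. 1 - g \<in> nonneg_cone d K}"

definition feasible_relax ::
    "nat \<Rightarrow> (nat \<Rightarrow> 'n::finite rpoly) \<Rightarrow> nat \<Rightarrow> nat \<Rightarrow> 'n rpoly set" where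
  "feasible_relax d w s k =
     {g \<in> polys_upto d. (\<forall>\<alpha>. exp_deg \<alpha> < d \<longrightarrow> mcoeff g \<alpha> = 0) \<and> 1 - g \<in> sos_cone w s k}"

end

theory Submission
  imports Defs
begin

text \<open>
  \<^bold>\<open>Existence and uniqueness.\<close> A homogeneous \<open>g\<close> with finite objective is nonnegative
  everywhere, because \<open>{g < 0}\<close> is invariant under dilation
  (\<open>eval_nonneg_if_objective_finite\<close>). A feasible \<open>g\<close> also satisfies \<open>g \<le> 1\<close> on \<open>K\<close>, whose
  interior is nonempty; so the feasible \<open>g\<close> with finite objective have bounded coefficients, and
  minimizing sequences have convergent subsequences. Fatou's lemma makes the objective lower
  semicontinuous, and \<open>exp\<close> is strictly convex. Hence every convex, closed set of feasible
  polynomials that contains one of finite objective has exactly one minimizer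
  (\<open>unique_optimal_exists\<close>). This applies to the feasible set of \<open>\<P>\<close>, and to that of \<open>\<P>\<^sub>k\<close> once it
  contains a small multiple \<open>g\<^sub>0\<close> of \<open>\<Sum>x\<^sub>i\<^sup>d\<close>, provided that the truncated cone \<open>\<C>\<^sub>k\<close> is closed.

  \<^bold>\<open>Closedness of the truncated cones\<close> (\<open>sos_cone_closed\<close>). Let \<open>\<Sum>\<sigma>\<^sub>j w\<^sub>j\<close> run through a convergent
  sequence. At interior points of \<open>K\<close> where no nonzero \<open>w\<^sub>j\<close> vanishes every term is nonnegative,
  hence every \<open>\<sigma>\<^sub>j\<close> is bounded there. Coefficients of polynomials of bounded degree are fixed linear
  combinations of values at points of any given open set (\<open>coefficient_functional\<close>), so the
  \<open>\<sigma>\<^sub>j\<close> have convergent subsequences. Their limits are sums of squares because the Gram matrices of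
  the \<open>\<sigma>\<^sub>j\<close> are bounded too (\<open>sos_closed\<close>).

  \<^bold>\<open>Convergence.\<close> The feasible sets of \<open>\<P>\<^sub>k\<close> increase with \<open>k\<close> and lie in that of \<open>\<P>\<close>, so
  \<open>\<rho>\<^sub>k\<close> decreases and \<open>\<rho> \<le> \<rho>\<^sub>k\<close>. With \<open>g\<^sub>0 < 1\<close> on \<open>K\<close>, the combination
  \<open>h = (1 - t) g\<^sup>* + t g\<^sub>0\<close> satisfies \<open>h < 1\<close> on \<open>K\<close> for every \<open>0 < t < 1\<close>. By Putinar's theorem
  (\<open>putinar_positivstellensatz\<close>) \<open>1 - h\<close> belongs to some \<open>\<C>\<^sub>k\<close>, and by convexity its objective is at
  most \<open>(1 - t) \<rho>\<close> plus \<open>t\<close> times that of \<open>g\<^sub>0\<close>; letting \<open>t\<close> tend to \<open>0\<close> gives \<open>\<rho>\<^sub>k \<longlonglongrightarrow> \<rho>\<close>. Finally,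
  every subsequence of the \<open>g\<^sub>k\<^sup>*\<close> has a subsequence converging to a feasible polynomial, whose
  objective is at most \<open>lim \<rho>\<^sub>k = \<rho>\<close> by Fatou's lemma; by uniqueness this limit is \<open>g\<^sup>*\<close>.
\<close>

section \<open>Evaluation of polynomials\<close>

abbreviation const_poly :: "real \<Rightarrow> 'n::finite rpoly" where
  "const_poly \<equiv> Poly_Mapping.single 0"

definition monomial_at :: "('n::finite \<Rightarrow>\<^sub>0 nat) \<Rightarrow> real ^ 'n \<Rightarrow> real" where
  "monomial_at \<alpha> x = (\<Prod>i\<in>UNIV. x $ i ^ Poly_Mapping.lookup \<alpha> i)"

lemma poly_sum_singles:
  "p = (\<Sum>\<alpha>\<in>Poly_Mapping.keys p. Poly_Mapping.single \<alpha> (Poly_Mapping.lookup p \<alpha>))"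
proof (rule poly_mapping_eqI)
  fix k
  show "Poly_Mapping.lookup p k =
      Poly_Mapping.lookup (\<Sum>\<alpha>\<in>Poly_Mapping.keys p. Poly_Mapping.single \<alpha> (Poly_Mapping.lookup p \<alpha>)) k"
    by (cases "k \<in> Poly_Mapping.keys p")
      (auto simp: lookup_sum lookup_single when_def sum.delta not_in_keys_iff_lookup_eq_zero)
qed

lemma eval_poly_superset:
  assumes "finite A" "Poly_Mapping.keys p \<subseteq> A"
  shows "eval_poly p x = (\<Sum>\<alpha>\<in>A. mcoeff p \<alpha> * monomial_at \<alpha> x)"
  unfolding eval_poly_def monomial_at_def
  by (rule sum.mono_neutral_left) (use assms in \<open>auto simp: in_keys_iff\<close>)

lemma eval_poly_single [simp]: "eval_poly (Poly_Mapping.single \<alpha> c) x = c * monomial_at \<alpha> x"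
  by (subst eval_poly_superset[of "{\<alpha>}"]) auto

lemma monomial_at_0 [simp]: "monomial_at 0 x = 1"
  by (simp add: monomial_at_def)

lemma monomial_at_add: "monomial_at (\<alpha> + \<beta>) x = monomial_at \<alpha> x * monomial_at \<beta> x"
  by (simp add: monomial_at_def lookup_add power_add prod.distrib)

lemma eval_poly_0 [simp]: "eval_poly 0 x = 0"
  by (simp add: eval_poly_def)

lemma eval_poly_1 [simp]: "eval_poly 1 x = 1"
  by (metis eval_poly_single monomial_at_0 mult_1 single_one)

lemma eval_poly_numeral [simp]: "eval_poly (numeral k) x = numeral k"
  by (metis eval_poly_single monomial_at_0 mult.right_neutral single_numeral)

lemma eval_poly_add [simp]: "eval_poly (p + q) x = eval_poly p x + eval_poly q x"
proof -
  let ?A = "Poly_Mapping.keys p \<union> Poly_Mapping.keys q"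
  have "Poly_Mapping.keys (p + q) \<subseteq> ?A" by (rule keys_add)
  then show ?thesis
    by (simp add: eval_poly_superset[of ?A] lookup_add algebra_simps sum.distrib)
qed

lemma eval_poly_minus [simp]: "eval_poly (- p) x = - eval_poly p x"
  using eval_poly_add[of p "- p" x] by simp

lemma eval_poly_diff [simp]: "eval_poly (p - q) x = eval_poly p x - eval_poly q x"
  using eval_poly_add[of p "- q" x] by simp

lemma eval_poly_sum [simp]: "eval_poly (\<Sum>i\<in>I. f i) x = (\<Sum>i\<in>I. eval_poly (f i) x)"
  by (induction I rule: infinite_finite_induct) auto

lemma eval_poly_mult [simp]: "eval_poly (p * q) x = eval_poly p x * eval_poly q x"
proof -
  let ?P = "Poly_Mapping.keys p" and ?Q = "Poly_Mapping.keys q"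
  have "p * q = (\<Sum>\<alpha>\<in>?P. \<Sum>\<beta>\<in>?Q. Poly_Mapping.single (\<alpha> + \<beta>) (mcoeff p \<alpha> * mcoeff q \<beta>))"
    by (subst poly_sum_singles[of p], subst poly_sum_singles[of q])
      (simp add: sum_product mult_single)
  then have "eval_poly (p * q) x =
      (\<Sum>\<alpha>\<in>?P. \<Sum>\<beta>\<in>?Q. (mcoeff p \<alpha> * monomial_at \<alpha> x) * (mcoeff q \<beta> * monomial_at \<beta> x))"
    by (simp add: monomial_at_add algebra_simps)
  then show ?thesis
    by (simp add: sum_product eval_poly_superset[OF finite_keys order_refl])
qed

lemma eval_poly_power [simp]: "eval_poly (p ^ k) x = eval_poly p x ^ k"
  by (induction k) auto

lemma mcoeff_const_mult [simp]: "mcoeff (const_poly c * p) \<alpha> = c * mcoeff p \<alpha>"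
proof -
  have "const_poly c * p = (\<Sum>\<beta>\<in>Poly_Mapping.keys p. Poly_Mapping.single \<beta> (c * mcoeff p \<beta>))"
    by (subst poly_sum_singles[of p]) (simp add: sum_distrib_left mult_single)
  then have "mcoeff (const_poly c * p) \<alpha>
      = (\<Sum>\<beta>\<in>Poly_Mapping.keys p. if \<beta> = \<alpha> then c * mcoeff p \<beta> else 0)"
    by (simp add: lookup_sum lookup_single when_def)
  also have "\<dots> = c * mcoeff p \<alpha>"
    by (auto simp: sum.delta not_in_keys_iff_lookup_eq_zero)
  finally show ?thesis .
qed

lemma const_poly_mult: "const_poly (a * b) = const_poly a * const_poly b"
  by (simp add: mult_single)

lemma const_poly_power: "const_poly (a ^ k) = const_poly a ^ k"
  by (induction k) (simp_all add: const_poly_mult single_one)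

lemma continuous_on_eval_poly: "continuous_on S (eval_poly p)"
proof -
  have "continuous_on S (\<lambda>x. eval_poly p x)"
    unfolding eval_poly_def by (intro continuous_intros)
  then show ?thesis by simp
qed

lemma eval_poly_borel [measurable]: "eval_poly p \<in> borel_measurable borel"
  by (rule borel_measurable_continuous_onI[OF continuous_on_eval_poly])

section \<open>Degrees\<close>

lemma exp_deg_0 [simp]: "exp_deg 0 = 0"
  by (simp add: exp_deg_def)

lemma exp_deg_add: "exp_deg (\<alpha> + \<beta>) = exp_deg \<alpha> + exp_deg \<beta>"
  by (simp add: exp_deg_def lookup_add sum.distrib)

lemma exp_deg_single [simp]: "exp_deg (Poly_Mapping.single i k) = k"
  by (simp add: exp_deg_def lookup_single when_def)

lemma lookup_le_exp_deg: "Poly_Mapping.lookup \<alpha> i \<le> exp_deg \<alpha>"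
  unfolding exp_deg_def by (rule member_le_sum) auto

lemma finite_exp_deg_le: "finite {\<alpha> :: 'n::finite \<Rightarrow>\<^sub>0 nat. exp_deg \<alpha> \<le> D}"
proof -
  have "finite {f :: 'n \<Rightarrow> nat. \<forall>i. f i \<in> {..D}}"
    using finite_set_of_finite_funs[of "UNIV :: 'n set" "{..D}"] by simp
  moreover have "Poly_Mapping.lookup ` {\<alpha> :: 'n \<Rightarrow>\<^sub>0 nat. exp_deg \<alpha> \<le> D} \<subseteq> {f. \<forall>i. f i \<in> {..D}}"
    using lookup_le_exp_deg order_trans by fastforce
  ultimately have "finite (Poly_Mapping.lookup ` {\<alpha> :: 'n \<Rightarrow>\<^sub>0 nat. exp_deg \<alpha> \<le> D})"
    by (rule rev_finite_subset)
  then show ?thesis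
    by (rule finite_imageD) (auto intro!: inj_onI poly_mapping_eqI)
qed

lemma polys_upto_keys: "p \<in> polys_upto D \<longleftrightarrow> Poly_Mapping.keys p \<subseteq> {\<alpha>. exp_deg \<alpha> \<le> D}"
  by (auto simp: polys_upto_def in_keys_iff)

lemma polys_upto_0 [simp]: "0 \<in> polys_upto D"
  and polys_upto_1 [simp]: "1 \<in> polys_upto D"
  by (auto simp: polys_upto_keys)

lemma polys_upto_single: "exp_deg \<alpha> \<le> D \<Longrightarrow> Poly_Mapping.single \<alpha> c \<in> polys_upto D"
  by (auto simp: polys_upto_keys)

lemma polys_upto_add: "p \<in> polys_upto D \<Longrightarrow> q \<in> polys_upto D \<Longrightarrow> p + q \<in> polys_upto D"
  unfolding polys_upto_keys using keys_add[of p q] by blast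

lemma polys_upto_sum: "(\<And>i. i \<in> I \<Longrightarrow> f i \<in> polys_upto D) \<Longrightarrow> (\<Sum>i\<in>I. f i) \<in> polys_upto D"
  by (induction I rule: infinite_finite_induct) (auto intro: polys_upto_add)

lemma polys_upto_mult:
  assumes "p \<in> polys_upto D" "q \<in> polys_upto E"
  shows "p * q \<in> polys_upto (D + E)"
proof -
  have "exp_deg \<alpha> \<le> D + E" if \<alpha>: "\<alpha> \<in> Poly_Mapping.keys (p * q)" for \<alpha>
  proof -
    obtain \<beta> \<gamma> where "\<alpha> = \<beta> + \<gamma>" "\<beta> \<in> Poly_Mapping.keys p" "\<gamma> \<in> Poly_Mapping.keys q"
      using \<alpha> keys_mult[of p q] by blast
    then show ?thesis
      using assms by (auto simp: exp_deg_add polys_upto_keys intro!: add_mono)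
  qed
  then show ?thesis by (auto simp: polys_upto_keys)
qed

lemma polys_upto_power2: "p \<in> polys_upto D \<Longrightarrow> p\<^sup>2 \<in> polys_upto (2 * D)"
  using polys_upto_mult[of p D p D] by (simp add: power2_eq_square mult_2)

lemma polys_upto_mono: "p \<in> polys_upto D \<Longrightarrow> D \<le> E \<Longrightarrow> p \<in> polys_upto E"
  by (auto simp: polys_upto_keys)

lemma polys_upto_exists: "\<exists>D. p \<in> polys_upto D"
proof -
  have "exp_deg \<alpha> \<le> Max (exp_deg ` Poly_Mapping.keys p)" if "\<alpha> \<in> Poly_Mapping.keys p" for \<alpha>
    using that by (intro Max_ge) auto
  then have "p \<in> polys_upto (Max (exp_deg ` Poly_Mapping.keys p))"
    by (auto simp: polys_upto_keys)
  then show ?thesis ..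
qed

lemma homog_polys_upto: "g \<in> homog_polys d \<Longrightarrow> g \<in> polys_upto d"
  by (auto simp: homog_polys_def polys_upto_def)

lemma eval_poly_upto:
  assumes "p \<in> polys_upto D"
  shows "eval_poly p x = (\<Sum>\<alpha> | exp_deg \<alpha> \<le> D. mcoeff p \<alpha> * monomial_at \<alpha> x)"
  by (rule eval_poly_superset) (use assms finite_exp_deg_le in \<open>auto simp: polys_upto_keys\<close>)

lemma monomial_at_scaleR: "monomial_at \<alpha> (t *\<^sub>R x) = t ^ exp_deg \<alpha> * monomial_at \<alpha> x"
  by (simp add: monomial_at_def exp_deg_def power_mult_distrib prod.distrib power_sum)

lemma eval_homog_scaleR:
  assumes "g \<in> homog_polys d"
  shows "eval_poly g (t *\<^sub>R x) = t ^ d * eval_poly g x"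
proof -
  have "mcoeff g \<alpha> * monomial_at \<alpha> (t *\<^sub>R x) = t ^ d * (mcoeff g \<alpha> * monomial_at \<alpha> x)" for \<alpha>
    using assms by (cases "mcoeff g \<alpha> = 0") (auto simp: homog_polys_def monomial_at_scaleR)
  then show ?thesis
    by (simp only: eval_poly_superset[OF finite_keys order_refl] sum_distrib_left)
qed

section \<open>Coefficients as combinations of point evaluations\<close>

text \<open>The functional that reads off the coefficient of \<open>x\<^sup>m\<close> by Lagrange interpolation at the nodes
  \<open>T\<close>.\<close>

lemma univariate_coefficient_functional:
  fixes T :: "real set"
  assumes T: "finite T" "card T = Suc D"
  shows "\<exists>c. \<forall>k\<le>D. (\<Sum>t\<in>T. c t * t ^ k) = (if k = m then 1 else 0)"
proof -
  define L where "L t = (\<Prod>s\<in>T - {t}. smult (1 / (t - s)) [:- s, 1:])" for t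
  have degL: "Polynomial.degree (L t) \<le> D" if "t \<in> T" for t
  proof -
    have "Polynomial.degree (L t) \<le> (\<Sum>s\<in>T - {t}. Polynomial.degree (smult (1 / (t - s)) [:- s, 1:]))"
      unfolding L_def by (rule order_trans[OF degree_prod_sum_le]) (use T in auto)
    also have "\<dots> \<le> (\<Sum>s\<in>T - {t}. 1)" by (intro sum_mono) simp
    also have "\<dots> = D" using T that by simp
    finally show ?thesis .
  qed
  have polyL: "poly (L t) s = (if s = t then 1 else 0)" if "s \<in> T" "t \<in> T" for s t
  proof (cases "s = t")
    case True
    then have "poly (L t) s = (\<Prod>r\<in>T - {t}. 1)"
      unfolding L_def poly_prod by (intro prod.cong) (auto simp: divide_simps)
    then show ?thesis using True by simp
  next
    case False
    then show ?thesis
      unfolding L_def poly_prod using that T by (auto intro!: prod_zero bexI[of _ s])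
  qed
  have "(\<Sum>t\<in>T. Polynomial.coeff (L t) m * t ^ k) = (if k = m then 1 else 0)" if "k \<le> D" for k
  proof -
    have "(\<Sum>t\<in>T. smult (t ^ k) (L t)) = Polynomial.monom 1 k"
    proof (rule poly_eqI_degree)
      fix s assume s: "s \<in> T"
      have "poly (\<Sum>t\<in>T. smult (t ^ k) (L t)) s = (\<Sum>t\<in>T. if s = t then t ^ k else 0)"
        unfolding poly_sum by (intro sum.cong) (auto simp: polyL s)
      also have "\<dots> = s ^ k" using s T by simp
      finally show "poly (\<Sum>t\<in>T. smult (t ^ k) (L t)) s = poly (Polynomial.monom 1 k) s"
        by (simp add: poly_monom)
    next
      show "Polynomial.degree (\<Sum>t\<in>T. smult (t ^ k) (L t)) < card T"
        unfolding T using degL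
        by (intro le_imp_less_Suc degree_sum_le T) (meson degree_smult_le order_trans)
      show "Polynomial.degree (Polynomial.monom 1 k :: real poly) < card T"
        using that T by (simp add: degree_monom_eq)
    qed
    then have "(\<Sum>t\<in>T. Polynomial.coeff (smult (t ^ k) (L t)) m) = Polynomial.coeff (Polynomial.monom 1 k) m"
      by (metis coeff_sum)
    then show ?thesis by (simp add: mult.commute)
  qed
  then show ?thesis by (intro exI[of _ "\<lambda>t. Polynomial.coeff (L t) m"]) blast
qed

text \<open>An open set contains a grid \<open>\<Prod>\<^sub>i T\<^sub>i\<close> with enough nodes in every direction, and on a grid the
  functional for \<open>\<beta>\<close> is the product of the univariate functionals for the \<open>\<beta>\<^sub>i\<close>. It makes every open
  set determine a polynomial of bounded degree, with control of the size.\<close>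

lemma coefficient_functional:
  fixes U :: "(real ^ 'n::finite) set"
  assumes "open U" "U \<noteq> {}"
  shows "\<exists>P c. finite P \<and> P \<subseteq> U \<and>
      (\<forall>p\<in>polys_upto D. mcoeff p \<beta> = (\<Sum>x\<in>P. c x * eval_poly p x))"
proof -
  obtain a where "a \<in> U" using assms by blast
  then obtain A where A: "\<And>i. open (A i)" "\<And>i. a $ i \<in> A i" "\<And>y. (\<forall>i. y $ i \<in> A i) \<Longrightarrow> y \<in> U"
    using \<open>open U\<close> unfolding open_vec_def by metis
  have "infinite (A i)" for i
    using A(1)[of i] A(2)[of i] not_open_singleton
    by (metis finite_imp_closed clopen equals0D infinite_UNIV_char_0)
  then have "\<forall>i. \<exists>B. finite B \<and> card B = Suc D \<and> B \<subseteq> A i"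
    using infinite_arbitrarily_large by blast
  then obtain T where T: "\<And>i. finite (T i)" "\<And>i. card (T i) = Suc D" "\<And>i. T i \<subseteq> A i"
    by metis
  have "\<forall>i. \<exists>c. \<forall>k\<le>D. (\<Sum>t\<in>T i. c t * t ^ k) = (if k = Poly_Mapping.lookup \<beta> i then 1 else 0)"
    using univariate_coefficient_functional T by blast
  then obtain c where c: "\<And>i k. k \<le> D \<Longrightarrow>
      (\<Sum>t\<in>T i. c i t * t ^ k) = (if k = Poly_Mapping.lookup \<beta> i then 1 else 0)"
    by metis
  define P where "P = vec_lambda ` PiE UNIV T"
  define C where "C x = (\<Prod>i\<in>UNIV. c i (x $ i))" for x :: "real ^ 'n"
  have finP: "finite P" unfolding P_def using T by (intro finite_imageI finite_PiE) auto
  have inj: "inj_on vec_lambda (PiE UNIV T)" by (rule inj_onI) (metis vec_lambda_inverse UNIV_I)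
  have "P \<subseteq> U" unfolding P_def using T(3) by (auto simp: PiE_def Pi_iff intro!: A(3) subsetD[OF T(3)])
  have mono: "(\<Sum>x\<in>P. C x * monomial_at \<alpha> x) = (if \<alpha> = \<beta> then 1 else 0)" if "exp_deg \<alpha> \<le> D" for \<alpha>
  proof -
    have "(\<Sum>x\<in>P. C x * monomial_at \<alpha> x) =
        (\<Sum>f\<in>PiE UNIV T. \<Prod>i\<in>UNIV. c i (f i) * f i ^ Poly_Mapping.lookup \<alpha> i)"
      unfolding P_def by (subst sum.reindex[OF inj]) (simp add: C_def monomial_at_def prod.distrib)
    also have "\<dots> = (\<Prod>i\<in>UNIV. \<Sum>t\<in>T i. c i t * t ^ Poly_Mapping.lookup \<alpha> i)"
      by (subst prod_sum_PiE) (use T in auto)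
    also have "\<dots> = (\<Prod>i\<in>UNIV. if Poly_Mapping.lookup \<alpha> i = Poly_Mapping.lookup \<beta> i then 1 else 0)"
      using lookup_le_exp_deg[of \<alpha>] that by (intro prod.cong refl c) (rule order_trans)
    also have "\<dots> = (if \<alpha> = \<beta> then 1 else 0)"
    proof (cases "\<alpha> = \<beta>")
      case False
      then obtain i where "Poly_Mapping.lookup \<alpha> i \<noteq> Poly_Mapping.lookup \<beta> i"
        by (metis poly_mapping_eqI)
      then show ?thesis using False by (auto intro!: prod_zero bexI[of _ i])
    qed simp
    finally show ?thesis .
  qed
  have "mcoeff p \<beta> = (\<Sum>x\<in>P. C x * eval_poly p x)" if p: "p \<in> polys_upto D" for p
  proof -
    have "(\<Sum>x\<in>P. C x * eval_poly p x) =
        (\<Sum>x\<in>P. \<Sum>\<alpha> | exp_deg \<alpha> \<le> D. mcoeff p \<alpha> * (C x * monomial_at \<alpha> x))"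
      by (simp add: eval_poly_upto[OF p] sum_distrib_left mult.left_commute)
    also have "\<dots> = (\<Sum>\<alpha> | exp_deg \<alpha> \<le> D. mcoeff p \<alpha> * (\<Sum>x\<in>P. C x * monomial_at \<alpha> x))"
      by (subst sum.swap) (simp add: sum_distrib_left)
    also have "\<dots> = (\<Sum>\<alpha> | exp_deg \<alpha> \<le> D. if \<alpha> = \<beta> then mcoeff p \<alpha> else 0)"
      by (intro sum.cong) (auto simp: mono)
    also have "\<dots> = mcoeff p \<beta>"
      using p by (auto simp: finite_exp_deg_le polys_upto_def)
    finally show ?thesis by simp
  qed
  with finP \<open>P \<subseteq> U\<close> show ?thesis by (intro exI[of _ P] exI[of _ C]) blast
qed

lemma poly_eq_0_if_vanishes_on_open:
  assumes "open U" "U \<noteq> {}" and "\<And>x. x \<in> U \<Longrightarrow> eval_poly p x = 0"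
  shows "p = 0"
proof (rule poly_mapping_eqI)
  fix \<beta>
  obtain D where "p \<in> polys_upto D" using polys_upto_exists by blast
  with coefficient_functional[OF assms(1,2), of D \<beta>] assms(3)
  show "mcoeff p \<beta> = mcoeff 0 \<beta>" by (force intro!: sum.neutral)
qed

lemma poly_eqI_eval: "(\<And>x. eval_poly p x = eval_poly q x) \<Longrightarrow> p = q"
  using poly_eq_0_if_vanishes_on_open[of UNIV "p - q"] by simp

section \<open>Coefficientwise convergence\<close>

lemma common_convergent_subsequence:
  fixes f :: "nat \<Rightarrow> 'a \<Rightarrow> real"
  assumes "finite A" and "\<And>a. a \<in> A \<Longrightarrow> \<exists>C. \<forall>m. \<bar>f m a\<bar> \<le> C"
  shows "\<exists>(r :: nat \<Rightarrow> nat) l. strict_mono r \<and> (\<forall>a\<in>A. (\<lambda>m. f (r m) a) \<longlonglongrightarrow> l a)"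
  using assms
proof (induction A)
  case empty
  then show ?case by (auto intro: exI[of _ id] simp: strict_mono_def)
next
  case (insert a A)
  then obtain r l where r: "strict_mono (r :: nat \<Rightarrow> nat)" "\<And>b. b \<in> A \<Longrightarrow> (\<lambda>m. f (r m) b) \<longlonglongrightarrow> l b"
    by blast
  obtain C where "\<And>m. \<bar>f m a\<bar> \<le> C" using insert.prems by blast
  then have "\<forall>m. f (r m) a \<in> {-C..C}" by (auto simp: abs_le_iff minus_le_iff)
  then obtain l' q where q: "strict_mono (q :: nat \<Rightarrow> nat)" "((\<lambda>m. f (r m) a) \<circ> q) \<longlonglongrightarrow> l'"
    using compact_Icc[of "-C" C, unfolded compact_def] by metis
  have "(\<lambda>m. f (r (q m)) b) \<longlonglongrightarrow> l b" if "b \<in> A" for b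
    using LIMSEQ_subseq_LIMSEQ[OF r(2)[OF that] q(1)] by (simp add: o_def)
  moreover have "strict_mono (r \<circ> q)" using r q by (simp add: strict_mono_o)
  ultimately show ?case
    using q(2) insert.hyps
    by (intro exI[of _ "r \<circ> q"] exI[of _ "l(a := l')"]) (auto simp: o_def)
qed

lemma eval_poly_tendsto:
  assumes "\<And>m. p m \<in> polys_upto D" "q \<in> polys_upto D"
    and "\<And>\<alpha>. (\<lambda>m. mcoeff (p m) \<alpha>) \<longlonglongrightarrow> mcoeff q \<alpha>"
  shows "(\<lambda>m. eval_poly (p m) x) \<longlonglongrightarrow> eval_poly q x"
  unfolding eval_poly_upto[OF assms(1)] eval_poly_upto[OF assms(2)]
  by (intro tendsto_sum tendsto_mult assms(3) tendsto_const)

text \<open>Since coefficients are combinations of point evaluations, pointwise boundedness on an open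
  set is enough for compactness.\<close>

lemma pointwise_bounded_polys_subsequence:
  fixes p :: "nat \<Rightarrow> 'j \<Rightarrow> 'n::finite rpoly"
  assumes U: "open U" "U \<noteq> {}" and J: "finite J"
    and p: "\<And>m j. j \<in> J \<Longrightarrow> p m j \<in> polys_upto D"
    and bd: "\<And>j x. j \<in> J \<Longrightarrow> x \<in> U \<Longrightarrow> \<exists>C. \<forall>m. \<bar>eval_poly (p m j) x\<bar> \<le> C"
  shows "\<exists>(r :: nat \<Rightarrow> nat) q. strict_mono r \<and> (\<forall>j. q j \<in> polys_upto D) \<and>
      (\<forall>j\<in>J. \<forall>\<alpha>. (\<lambda>m. mcoeff (p (r m) j) \<alpha>) \<longlonglongrightarrow> mcoeff (q j) \<alpha>)"
proof -
  let ?E = "{\<alpha> :: 'n \<Rightarrow>\<^sub>0 nat. exp_deg \<alpha> \<le> D}"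
  have "\<exists>C. \<forall>m. \<bar>mcoeff (p m j) \<beta>\<bar> \<le> C" if j: "j \<in> J" for j \<beta>
  proof -
    obtain P c where P: "finite P" "P \<subseteq> U"
      "\<And>p. p \<in> polys_upto D \<Longrightarrow> mcoeff p \<beta> = (\<Sum>x\<in>P. c x * eval_poly p x)"
      using coefficient_functional[OF U, of D \<beta>] by blast
    obtain C where C: "\<And>x m. x \<in> P \<Longrightarrow> \<bar>eval_poly (p m j) x\<bar> \<le> C x"
      using bd[OF j] P(2) by (metis subsetD)
    have "\<bar>mcoeff (p m j) \<beta>\<bar> \<le> (\<Sum>x\<in>P. \<bar>c x\<bar> * C x)" for m
      unfolding P(3)[OF p[OF j]]
      by (rule order_trans[OF sum_abs]) (auto simp: abs_mult intro!: sum_mono mult_left_mono C)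
    then show ?thesis by blast
  qed
  then have "\<And>a. a \<in> J \<times> ?E \<Longrightarrow> \<exists>C. \<forall>m. \<bar>mcoeff (p m (fst a)) (snd a)\<bar> \<le> C"
    by auto
  then obtain r l where r: "strict_mono (r :: nat \<Rightarrow> nat)"
    "\<forall>a\<in>J \<times> ?E. (\<lambda>m. mcoeff (p (r m) (fst a)) (snd a)) \<longlonglongrightarrow> l a"
    using common_convergent_subsequence[of "J \<times> ?E" "\<lambda>m a. mcoeff (p m (fst a)) (snd a)"]
      J finite_exp_deg_le by blast
  define q where "q j = (\<Sum>\<alpha>\<in>?E. Poly_Mapping.single \<alpha> (l (j, \<alpha>)))" for j
  have q: "mcoeff (q j) \<alpha> = (if exp_deg \<alpha> \<le> D then l (j, \<alpha>) else 0)" for j \<alpha>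
    by (simp add: q_def lookup_sum lookup_single when_def finite_exp_deg_le)
  have "(\<lambda>m. mcoeff (p (r m) j) \<alpha>) \<longlonglongrightarrow> mcoeff (q j) \<alpha>" if "j \<in> J" for j \<alpha>
  proof (cases "exp_deg \<alpha> \<le> D")
    case True
    then show ?thesis using r(2) that by (force simp: q)
  next
    case False
    then have "mcoeff (p (r m) j) \<alpha> = 0" for m
      using p[OF that] by (auto simp: polys_upto_def)
    then show ?thesis using False by (simp add: q)
  qed
  moreover have "q j \<in> polys_upto D" for j
    unfolding q_def by (rule polys_upto_sum) (auto intro: polys_upto_single)
  ultimately show ?thesis using r(1) by blast
qed

section \<open>Archimedean quadratic modules and Putinar's theorem\<close>

abbreviation var_poly :: "'n::finite \<Rightarrow> 'n rpoly" where
  "var_poly i \<equiv> Poly_Mapping.single (Poly_Mapping.single i 1) 1"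

lemma eval_poly_prod [simp]: "eval_poly (\<Prod>i\<in>I. f i) x = (\<Prod>i\<in>I. eval_poly (f i) x)"
  by (induction I rule: infinite_finite_induct) auto

lemma monomial_at_single [simp]: "monomial_at (Poly_Mapping.single i k) x = x $ i ^ k"
proof -
  have "monomial_at (Poly_Mapping.single i k) x = (\<Prod>j\<in>UNIV. if j = i then x $ i ^ k else 1)"
    unfolding monomial_at_def by (intro prod.cong) (auto simp: lookup_single when_def)
  then show ?thesis by simp
qed

lemma rpoly_induct [case_names const var add mult]:
  fixes p :: "'n::finite rpoly"
  assumes const: "\<And>c. P (const_poly c)" and var: "\<And>i. P (var_poly i)"
    and add: "\<And>a b. P a \<Longrightarrow> P b \<Longrightarrow> P (a + b)" and mult: "\<And>a b. P a \<Longrightarrow> P b \<Longrightarrow> P (a * b)"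
  shows "P p"
proof -
  have pow: "P (a ^ k)" if "P a" for a k
    using that const[of 1] by (induction k) (auto intro: mult simp: single_one)
  have prod: "P (\<Prod>i\<in>I. f i)" if "\<And>i. P (f i)" for f and I :: "'n set"
    using that const[of 1] by (induction I rule: infinite_finite_induct) (auto intro: mult simp: single_one)
  have single: "Poly_Mapping.single \<alpha> c = const_poly c * (\<Prod>i\<in>UNIV. var_poly i ^ Poly_Mapping.lookup \<alpha> i)"
    for \<alpha> :: "'n \<Rightarrow>\<^sub>0 nat" and c
    by (rule poly_eqI_eval, simp) (simp add: monomial_at_def)
  have P_single: "P (Poly_Mapping.single \<alpha> c)" for \<alpha> c
    by (subst single) (intro mult const prod pow var)
  have P_sum: "P (\<Sum>\<alpha>\<in>A. f \<alpha>)" if "\<And>\<alpha>. P (f \<alpha>)" for f and A :: "('n \<Rightarrow>\<^sub>0 nat) set"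
    using that const[of 0] by (induction A rule: infinite_finite_induct) (auto intro: add)
  have "P (\<Sum>\<alpha>\<in>Poly_Mapping.keys p. Poly_Mapping.single \<alpha> (mcoeff p \<alpha>))"
    by (rule P_sum) (rule P_single)
  then show ?thesis by (simp flip: poly_sum_singles)
qed

definition quadratic_module :: "'n::finite rpoly set \<Rightarrow> bool" where
  "quadratic_module M \<longleftrightarrow> 1 \<in> M \<and> (\<forall>a\<in>M. \<forall>b\<in>M. a + b \<in> M) \<and> (\<forall>a\<in>M. \<forall>b. b\<^sup>2 * a \<in> M)"

text \<open>The constant \<open>1\<close> is an order unit.\<close>

definition archimedean_module :: "'n::finite rpoly set \<Rightarrow> bool" where
  "archimedean_module M \<longleftrightarrow> (\<forall>a. \<exists>N. const_poly N - a \<in> M)"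

lemma qm_1: "quadratic_module M \<Longrightarrow> 1 \<in> M"
  and qm_add: "quadratic_module M \<Longrightarrow> a \<in> M \<Longrightarrow> b \<in> M \<Longrightarrow> a + b \<in> M"
  and qm_square_mult: "quadratic_module M \<Longrightarrow> a \<in> M \<Longrightarrow> b\<^sup>2 * a \<in> M"
  by (auto simp: quadratic_module_def)

lemma qm_square: "quadratic_module M \<Longrightarrow> b\<^sup>2 \<in> M"
  using qm_square_mult[OF _ qm_1, of M b] by simp

lemma qm_scale:
  assumes "quadratic_module M" "a \<in> M" "0 \<le> c"
  shows "const_poly c * a \<in> M"
proof -
  have "const_poly c = (const_poly (sqrt c))\<^sup>2"
    using assms by (simp flip: const_poly_power)
  then show ?thesis using assms by (metis qm_square_mult)
qed

lemma qm_const: "quadratic_module M \<Longrightarrow> 0 \<le> c \<Longrightarrow> const_poly c \<in> M"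
  using qm_scale[OF _ qm_1, of M c] by simp

lemma qm_unscale:
  assumes "quadratic_module M" "const_poly c * a \<in> M" "0 < c"
  shows "a \<in> M"
proof -
  have "const_poly (1 / c) * (const_poly c * a) = a"
    using assms by (simp add: mult.assoc[symmetric] single_one flip: const_poly_mult)
  then show ?thesis using qm_scale[OF assms(1,2), of "1 / c"] assms(3) by simp
qed

lemma qm_neg_const:
  assumes "quadratic_module M" "const_poly c \<in> M" "c < 0"
  shows "- 1 \<in> M"
proof (rule qm_unscale[OF assms(1)])
  show "const_poly (- c) * (- 1) \<in> M" using assms by (simp add: single_uminus)
qed (use assms in simp)

lemma qm_sum:
  "quadratic_module M \<Longrightarrow> (\<And>i. i \<in> I \<Longrightarrow> f i \<in> M) \<Longrightarrow> (\<Sum>i\<in>I. f i) \<in> M"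
  by (induction I rule: infinite_finite_induct)
    (auto intro: qm_add dest: qm_const[of M 0])

text \<open>The identity \<open>(N - a)\<^sup>2 (N + a) + (N + a)\<^sup>2 (N - a) = 2 N (N\<^sup>2 - a\<^sup>2)\<close> turns a two-sided bound
  on an element into a bound on its square, although a quadratic module need not be closed under
  products.\<close>

lemma qm_bound_square:
  assumes M: "quadratic_module M" and "0 < N"
    and "const_poly N - a \<in> M" "const_poly N + a \<in> M"
  shows "const_poly (N\<^sup>2) - a\<^sup>2 \<in> M"
proof (rule qm_unscale[OF M])
  let ?n = "const_poly N"
  have "const_poly (2 * N) * (const_poly (N\<^sup>2) - a\<^sup>2) = (?n + ?n) * (?n\<^sup>2 - a\<^sup>2)"
    by (simp add: const_poly_power flip: single_add)
  also have "\<dots> = (?n - a)\<^sup>2 * (?n + a) + (?n + a)\<^sup>2 * (?n - a)"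
    by (simp add: algebra_simps power2_eq_square)
  also have "\<dots> \<in> M"
    by (intro qm_add[OF M qm_square_mult[OF M] qm_square_mult[OF M]] assms)
  finally show "const_poly (2 * N) * (const_poly (N\<^sup>2) - a\<^sup>2) \<in> M" .
qed (use assms in simp)

lemma polarization:
  "const_poly (1 / 4) * ((a + b)\<^sup>2 + const_poly (- 1) * (a - b)\<^sup>2) = a * b"
  by (rule poly_eqI_eval) (simp add: power2_eq_square field_simps)

text \<open>The elements bounded on both sides form a ring; it contains the variables because
  \<open>M - x\<^sub>i\<^sup>2\<close> is \<open>M - \<parallel>x\<parallel>\<^sup>2\<close> plus squares.\<close>

lemma archimedean_module_if_ball:
  fixes M :: "'n::finite rpoly set"
  assumes M: "quadratic_module M" and ball: "ball_poly N \<in> M"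
  shows "archimedean_module M"
proof -
  define H where "H a \<longleftrightarrow> (\<exists>N>0. const_poly N - a \<in> M \<and> const_poly N + a \<in> M)" for a
  have H_I: "H a" if "const_poly N1 - a \<in> M" "const_poly N2 + a \<in> M" for a N1 N2
  proof -
    define N where "N = max 1 (max N1 N2)"
    have "const_poly N - a = const_poly (N - N1) + (const_poly N1 - a)"
      "const_poly N + a = const_poly (N - N2) + (const_poly N2 + a)"
      by (simp_all add: algebra_simps flip: single_add)
    moreover have "0 \<le> N - N1" "0 \<le> N - N2" "0 < N" by (auto simp: N_def)
    ultimately show ?thesis
      unfolding H_def using that by (metis qm_add[OF M] qm_const[OF M])
  qed
  have H_add: "H (a + b)" if "H a" "H b" for a b
  proof -
    obtain N1 N2 where "const_poly N1 - a \<in> M" "const_poly N1 + a \<in> M"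
      "const_poly N2 - b \<in> M" "const_poly N2 + b \<in> M"
      using \<open>H a\<close> \<open>H b\<close> unfolding H_def by blast
    then have "(const_poly N1 - a) + (const_poly N2 - b) \<in> M" "(const_poly N1 + a) + (const_poly N2 + b) \<in> M"
      by (auto intro: qm_add[OF M])
    then show ?thesis
      by (intro H_I[of "N1 + N2" _ "N1 + N2"]) (simp_all add: single_add algebra_simps)
  qed
  have H_const: "H (const_poly c)" for c
    by (rule H_I[of c _ "- c"]) (use qm_const[OF M, of 0] in \<open>simp_all flip: single_add\<close>)
  have H_square: "H (a\<^sup>2)" if Ha: "H a" for a
  proof -
    obtain N where "0 < N" "const_poly N - a \<in> M" "const_poly N + a \<in> M"
      using Ha unfolding H_def by blast
    then have "const_poly (N\<^sup>2) - a\<^sup>2 \<in> M" by (rule qm_bound_square[OF M])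
    moreover have "const_poly 0 + a\<^sup>2 \<in> M" by (simp add: qm_square[OF M])
    ultimately show ?thesis by (rule H_I)
  qed
  have H_scale: "H (const_poly c * a)" if Ha: "H a" for a c
  proof -
    obtain N where N: "const_poly N - a \<in> M" "const_poly N + a \<in> M"
      using Ha unfolding H_def by blast
    have *: "const_poly \<bar>c\<bar> * (const_poly N - a) \<in> M" "const_poly \<bar>c\<bar> * (const_poly N + a) \<in> M"
      using N by (auto intro: qm_scale[OF M])
    show ?thesis
    proof (cases "0 \<le> c")
      case True
      with * show ?thesis
        by (intro H_I[of "c * N" _ "c * N"]) (simp_all add: algebra_simps const_poly_mult)
    next
      case False
      then have "const_poly (- c * N) - const_poly c * a = const_poly \<bar>c\<bar> * (const_poly N + a)"
        "const_poly (- c * N) + const_poly c * a = const_poly \<bar>c\<bar> * (const_poly N - a)"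
        by (auto intro!: poly_eqI_eval simp: algebra_simps)
      with * show ?thesis by (intro H_I[of "- c * N" _ "- c * N"]) simp_all
    qed
  qed
  have H_minus: "H (- a)" if "H a" for a
    using H_scale[OF that, of "- 1"] by (simp add: single_uminus)
  have "H p" for p
  proof (induction p rule: rpoly_induct)
    case (var i)
    have "ball_poly N + (\<Sum>j\<in>UNIV - {i}. (var_poly j)\<^sup>2) = const_poly N - (var_poly i)\<^sup>2"
      unfolding ball_poly_def by (subst sum.remove[of UNIV i]) (auto simp: algebra_simps)
    moreover have "ball_poly N + (\<Sum>j\<in>UNIV - {i}. (var_poly j)\<^sup>2) \<in> M"
      by (intro qm_add[OF M] ball qm_sum[OF M] qm_square[OF M])
    ultimately have *: "const_poly N - (var_poly i)\<^sup>2 \<in> M" by simp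
    have "const_poly (N + 1 / 4) - var_poly i =
        (const_poly N - (var_poly i)\<^sup>2) + (var_poly i - const_poly (1 / 2))\<^sup>2"
      "const_poly (N + 1 / 4) + var_poly i =
        (const_poly N - (var_poly i)\<^sup>2) + (var_poly i + const_poly (1 / 2))\<^sup>2"
      by (rule poly_eqI_eval, simp add: power2_eq_square field_simps)+
    then show ?case
      by (intro H_I[of "N + 1 / 4" _ "N + 1 / 4"]) (metis * qm_add[OF M] qm_square[OF M])+
  next
    case (mult a b)
    have "H (a - b)" using H_add[OF mult(1) H_minus[OF mult(2)]] by simp
    then show ?case
      using mult by (subst polarization[symmetric]) (intro H_scale H_add H_square)
  qed (auto intro: H_const H_add)
  then show ?thesis
    unfolding archimedean_module_def H_def by blast
qed

inductive_set sum_squares :: "'n::finite rpoly set" where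
  zero: "0 \<in> sum_squares"
| add_square: "a \<in> sum_squares \<Longrightarrow> q\<^sup>2 + a \<in> sum_squares"

lemma sum_squares_add: "a \<in> sum_squares \<Longrightarrow> b \<in> sum_squares \<Longrightarrow> a + b \<in> sum_squares"
  by (induction a rule: sum_squares.induct) (auto simp: add.assoc intro: sum_squares.intros)

lemma sum_squares_square_mult: "a \<in> sum_squares \<Longrightarrow> b\<^sup>2 * a \<in> sum_squares"
  by (induction a rule: sum_squares.induct)
    (auto simp: distrib_left intro: sum_squares.intros simp flip: power_mult_distrib)

lemma sum_squares_1: "1 \<in> sum_squares"
  using sum_squares.add_square[OF sum_squares.zero, of 1] by simp

lemma qm_sum_squares_mult:
  assumes "quadratic_module M" "a \<in> M"
  shows "\<sigma> \<in> sum_squares \<Longrightarrow> \<sigma> * a \<in> M"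
  by (induction \<sigma> rule: sum_squares.induct)
    (use assms qm_const[of M 0] in \<open>auto simp: distrib_right intro: qm_add qm_square_mult\<close>)

lemma qm_sum_squares: "quadratic_module M \<Longrightarrow> \<sigma> \<in> sum_squares \<Longrightarrow> \<sigma> \<in> M"
  using qm_sum_squares_mult[OF _ qm_1, of M \<sigma>] by simp

definition adjoin :: "'n::finite rpoly set \<Rightarrow> 'n rpoly \<Rightarrow> 'n rpoly set" where
  "adjoin M a = {m + \<sigma> * a | m \<sigma>. m \<in> M \<and> \<sigma> \<in> sum_squares}"

lemma quadratic_module_adjoin:
  assumes M: "quadratic_module M"
  shows "quadratic_module (adjoin M a)"
  unfolding quadratic_module_def
proof (intro conjI ballI allI)
  show "1 \<in> adjoin M a"
    unfolding adjoin_def using qm_1[OF M] sum_squares.zero by force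
next
  fix x y assume "x \<in> adjoin M a" "y \<in> adjoin M a"
  then obtain m \<sigma> m' \<sigma>' where "x = m + \<sigma> * a" "y = m' + \<sigma>' * a"
    "m \<in> M" "m' \<in> M" "\<sigma> \<in> sum_squares" "\<sigma>' \<in> sum_squares"
    unfolding adjoin_def by blast
  moreover have "(m + \<sigma> * a) + (m' + \<sigma>' * a) = (m + m') + (\<sigma> + \<sigma>') * a"
    by (simp add: algebra_simps)
  ultimately show "x + y \<in> adjoin M a"
    unfolding adjoin_def using qm_add[OF M] sum_squares_add by blast
next
  fix x b assume "x \<in> adjoin M a"
  then obtain m \<sigma> where "x = m + \<sigma> * a" "m \<in> M" "\<sigma> \<in> sum_squares"
    unfolding adjoin_def by blast
  moreover have "b\<^sup>2 * (m + \<sigma> * a) = b\<^sup>2 * m + (b\<^sup>2 * \<sigma>) * a"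
    by (simp add: algebra_simps)
  ultimately show "b\<^sup>2 * x \<in> adjoin M a"
    unfolding adjoin_def using qm_square_mult[OF M] sum_squares_square_mult by blast
qed

lemma adjoin_superset: "M \<subseteq> adjoin M a"
  unfolding adjoin_def using sum_squares.zero by force

lemma adjoin_member: "quadratic_module M \<Longrightarrow> a \<in> adjoin M a"
  unfolding adjoin_def using qm_const[of M 0] sum_squares_1
  by (intro CollectI exI[of _ 0] exI[of _ 1]) auto

lemma maximal_proper_quadratic_module_exists:
  assumes "quadratic_module M" "- 1 \<notin> M"
  shows "\<exists>Q. quadratic_module Q \<and> M \<subseteq> Q \<and> - 1 \<notin> Q \<and>
      (\<forall>Q'. quadratic_module Q' \<and> Q \<subseteq> Q' \<and> - 1 \<notin> Q' \<longrightarrow> Q' = Q)"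
proof -
  let ?A = "{Q. quadratic_module Q \<and> M \<subseteq> Q \<and> - 1 \<notin> Q}"
  have "\<exists>Q\<in>?A. \<forall>X\<in>?A. Q \<subseteq> X \<longrightarrow> X = Q"
  proof (rule subset_Zorn_nonempty)
    show "?A \<noteq> {}" using assms by blast
  next
    fix C assume C: "C \<noteq> {}" "subset.chain ?A C"
    have sub: "C \<subseteq> ?A" and ch: "\<And>X Y. X \<in> C \<Longrightarrow> Y \<in> C \<Longrightarrow> X \<subseteq> Y \<or> Y \<subseteq> X"
      using C(2) unfolding subset_chain_def by blast+
    have "quadratic_module (\<Union>C)"
      unfolding quadratic_module_def
    proof (intro conjI ballI allI)
      show "1 \<in> \<Union>C" using C(1) sub qm_1 by blast
    next
      fix a b assume "a \<in> \<Union>C" "b \<in> \<Union>C"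
      then obtain X Y where "X \<in> C" "Y \<in> C" "a \<in> X" "b \<in> Y" by blast
      then obtain Z where "Z \<in> C" "a \<in> Z" "b \<in> Z" using ch by blast
      then show "a + b \<in> \<Union>C" using sub qm_add by blast
    next
      fix a b assume "a \<in> \<Union>C"
      then show "b\<^sup>2 * a \<in> \<Union>C" using sub qm_square_mult by blast
    qed
    moreover have "M \<subseteq> \<Union>C" using C(1) sub by blast
    moreover have "- 1 \<notin> \<Union>C" using sub by auto
    ultimately show "\<Union>C \<in> ?A" by simp
  qed
  then obtain Q where "Q \<in> ?A" "\<forall>X\<in>?A. Q \<subseteq> X \<longrightarrow> X = Q" ..
  then show ?thesis by (intro exI[of _ Q]) auto
qed

text \<open>A maximal proper quadratic module \<open>Q\<close> orders the ring totally: if neither \<open>a\<close> nor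
  \<open>- a\<close> lies in \<open>Q\<close>, then maximality gives \<open>-1 = q + \<sigma> a = q' - \<tau> a\<close>, and eliminating \<open>a\<close> shows
  that \<open>\<sigma>\<close> lies in the ideal \<open>Q \<inter> - Q\<close>, whence \<open>-1 \<in> Q\<close>.\<close>

lemma maximal_quadratic_module_total:
  assumes Q: "quadratic_module Q" "- 1 \<notin> Q"
    and max: "\<And>Q'. quadratic_module Q' \<Longrightarrow> Q \<subseteq> Q' \<Longrightarrow> - 1 \<notin> Q' \<Longrightarrow> Q' = Q"
  shows "a \<in> Q \<or> - a \<in> Q"
proof (rule ccontr)
  assume "\<not> (a \<in> Q \<or> - a \<in> Q)"
  then have "- 1 \<in> adjoin Q a" "- 1 \<in> adjoin Q (- a)"
    using max[OF quadratic_module_adjoin[OF Q(1)] adjoin_superset] adjoin_member[OF Q(1)] by blast+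
  then obtain q \<sigma> q' \<tau> where *: "- 1 = q + \<sigma> * a" "q \<in> Q" "\<sigma> \<in> sum_squares"
    "- 1 = q' + \<tau> * (- a)" "q' \<in> Q" "\<tau> \<in> sum_squares"
    unfolding adjoin_def by blast
  have q: "q = - 1 - \<sigma> * a" "q' = - 1 + \<tau> * a"
    using *(1,4) by (simp_all add: algebra_simps)
  have "\<tau> * q + \<sigma> * q' + \<tau> \<in> Q"
    by (rule qm_add[OF Q(1) qm_add[OF Q(1)]])
      (use * in \<open>auto intro: qm_sum_squares_mult[OF Q(1)] qm_sum_squares[OF Q(1)]\<close>)
  also have "\<tau> * q + \<sigma> * q' + \<tau> = - \<sigma>"
    by (simp add: q algebra_simps)
  finally have neg: "- \<sigma> \<in> Q" .
  \<comment> \<open>a multiple of \<open>\<sigma>\<close> is a difference of two squares times \<open>\<sigma>\<close>\<close>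
  have "((a + 1) * const_poly (1 / 2))\<^sup>2 * \<sigma> + ((a - 1) * const_poly (1 / 2))\<^sup>2 * (- \<sigma>) \<in> Q"
    by (rule qm_add[OF Q(1) qm_square_mult[OF Q(1) qm_sum_squares[OF Q(1) *(3)]] qm_square_mult[OF Q(1) neg]])
  also have "((a + 1) * const_poly (1 / 2))\<^sup>2 * \<sigma> + ((a - 1) * const_poly (1 / 2))\<^sup>2 * (- \<sigma>) = \<sigma> * a"
    by (rule poly_eqI_eval) (simp add: power2_eq_square field_simps)
  finally have "q + \<sigma> * a \<in> Q" using *(2) by (intro qm_add[OF Q(1)])
  then show False using *(1) Q(2) by simp
qed

text \<open>Order completeness of the reals turns such a \<open>Q\<close> into a real-valued homomorphism: each \<open>a\<close>
  determines the cut of the constants below and above it. A homomorphism on the polynomial ring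
  is evaluation at the point formed by the values of the variables.\<close>

lemma archimedean_point_exists:
  fixes M :: "'n::finite rpoly set"
  assumes M: "quadratic_module M" "- 1 \<notin> M" and arch: "archimedean_module M"
  shows "\<exists>x. \<forall>q\<in>M. 0 \<le> eval_poly q x"
proof -
  obtain Q where Q: "quadratic_module Q" and MQ: "M \<subseteq> Q" and proper: "- 1 \<notin> Q"
    and max: "\<And>Q'. quadratic_module Q' \<Longrightarrow> Q \<subseteq> Q' \<Longrightarrow> - 1 \<notin> Q' \<Longrightarrow> Q' = Q"
    using maximal_proper_quadratic_module_exists[OF M] by blast
  have total: "a \<in> Q \<or> - a \<in> Q" for a
    using maximal_quadratic_module_total[OF Q proper max] by blast
  have const_Q: "0 \<le> c" if "const_poly c \<in> Q" for c
    using qm_neg_const[OF Q that] proper by force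
  \<comment> \<open>\<open>c\<close> is the value of \<open>a\<close> in the order induced by \<open>Q\<close>, up to infinitesimals\<close>
  define near where "near a c \<longleftrightarrow>
    (\<forall>e>0. a + const_poly (e - c) \<in> Q \<and> const_poly (e + c) - a \<in> Q)" for a c
  have near_exists: "\<exists>c. near a c" for a
  proof -
    obtain N1 N2 where N: "const_poly N1 - a \<in> Q" "const_poly N2 - (- a) \<in> Q"
      using arch MQ unfolding archimedean_module_def by blast
    define S where "S = {r. a - const_poly r \<in> Q}"
    have "- N2 \<in> S" using N(2) by (simp add: S_def single_uminus add.commute)
    have bdd: "r \<le> N1" if "r \<in> S" for r
    proof -
      have "(const_poly N1 - a) + (a - const_poly r) \<in> Q"
        using N(1) that by (intro qm_add[OF Q]) (auto simp: S_def)
      then have "const_poly (N1 - r) \<in> Q" by (simp add: single_diff)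
      then show ?thesis using const_Q by force
    qed
    have "near a (Sup S)"
      unfolding near_def
    proof (intro allI impI conjI)
      fix e :: real assume "e > 0"
      then obtain r where r: "r \<in> S" "Sup S - e < r"
        using \<open>- N2 \<in> S\<close> less_cSupD[of S "Sup S - e"] by force
      have "(a - const_poly r) + const_poly (r + e - Sup S) \<in> Q"
        using r by (intro qm_add[OF Q] qm_const[OF Q]) (auto simp: S_def)
      then show "a + const_poly (e - Sup S) \<in> Q"
        by (simp add: single_diff single_add algebra_simps)
    next
      fix e :: real assume "e > 0"
      then have "e + Sup S \<notin> S"
        using cSup_upper[of "e + Sup S" S] bdd by (force intro: bdd_aboveI)
      then show "const_poly (e + Sup S) - a \<in> Q"
        using total[of "a - const_poly (e + Sup S)"] by (simp add: S_def)
    qed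
    then show ?thesis ..
  qed
  have near_add: "near (a + b) (c + d)" if ab: "near a c" "near b d" for a b c d
    unfolding near_def
  proof (intro allI impI)
    fix e :: real assume "e > 0"
    then have "(a + const_poly (e / 2 - c)) + (b + const_poly (e / 2 - d)) \<in> Q"
      "(const_poly (e / 2 + c) - a) + (const_poly (e / 2 + d) - b) \<in> Q"
      using ab unfolding near_def by (metis half_gt_zero qm_add[OF Q])+
    moreover have "(a + const_poly (e / 2 - c)) + (b + const_poly (e / 2 - d)) = (a + b) + const_poly (e - (c + d))"
      "(const_poly (e / 2 + c) - a) + (const_poly (e / 2 + d) - b) = const_poly (e + (c + d)) - (a + b)"
      by (rule poly_eqI_eval, simp)+
    ultimately show "a + b + const_poly (e - (c + d)) \<in> Q \<and> const_poly (e + (c + d)) - (a + b) \<in> Q"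
      by simp
  qed
  have near_const: "near (const_poly c) c" for c
    unfolding near_def by (auto simp flip: single_add single_diff intro!: qm_const[OF Q])
  have near_minus: "near (- a) (- c)" if "near a c" for a c
    using that unfolding near_def by (auto simp: algebra_simps)
  have near_scale_pos: "near (const_poly t * a) (t * c)" if ac: "near a c" and "t > 0" for a c t
    unfolding near_def
  proof (intro allI impI)
    fix e :: real assume "e > 0"
    then have "a + const_poly (e / t - c) \<in> Q" "const_poly (e / t + c) - a \<in> Q"
      using ac \<open>t > 0\<close> unfolding near_def by auto
    then have "const_poly t * (a + const_poly (e / t - c)) \<in> Q" "const_poly t * (const_poly (e / t + c) - a) \<in> Q"
      using \<open>t > 0\<close> by (auto intro: qm_scale[OF Q])
    moreover have "const_poly t * (a + const_poly (e / t - c)) = const_poly t * a + const_poly (e - t * c)"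
      "const_poly t * (const_poly (e / t + c) - a) = const_poly (e + t * c) - const_poly t * a"
      using \<open>t > 0\<close> by (auto intro!: poly_eqI_eval simp: algebra_simps)
    ultimately show "const_poly t * a + const_poly (e - t * c) \<in> Q \<and> const_poly (e + t * c) - const_poly t * a \<in> Q"
      by simp
  qed
  have near_scale: "near (const_poly t * a) (t * c)" if ac: "near a c" for a c t
  proof (cases t "0 :: real" rule: linorder_cases)
    case less
    then have "near (const_poly (- t) * a) (- t * c)" by (intro near_scale_pos ac) simp
    then have "near (- (const_poly (- t) * a)) (- (- t * c))" by (rule near_minus)
    then show ?thesis by (simp add: single_uminus)
  next
    case equal
    then show ?thesis using near_const[of 0] by simp
  qed (rule near_scale_pos[OF ac])
  have near_square_0: "near (a\<^sup>2) 0" if a: "near a 0" for a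
    unfolding near_def
  proof (intro allI impI conjI)
    fix e :: real assume "e > 0"
    then show "a\<^sup>2 + const_poly (e - 0) \<in> Q"
      by (intro qm_add[OF Q] qm_square[OF Q] qm_const[OF Q]) auto
    have "const_poly (sqrt e) - a \<in> Q" "const_poly (sqrt e) + a \<in> Q"
      using a \<open>e > 0\<close> unfolding near_def by (auto simp: add.commute)
    then have "const_poly ((sqrt e)\<^sup>2) - a\<^sup>2 \<in> Q"
      using \<open>e > 0\<close> by (intro qm_bound_square[OF Q]) auto
    then show "const_poly (e + 0) - a\<^sup>2 \<in> Q" using \<open>e > 0\<close> by simp
  qed
  have near_square: "near (a\<^sup>2) (c\<^sup>2)" if ac: "near a c" for a c
  proof -
    have "near (a + const_poly (- c)) (c + - c)" by (intro near_add ac near_const)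
    then have "near ((a + const_poly (- c))\<^sup>2) 0" by (intro near_square_0) simp
    then have "near ((a + const_poly (- c))\<^sup>2 + (const_poly (2 * c) * a + const_poly (- (c\<^sup>2)))) (0 + (2 * c * c + - (c\<^sup>2)))"
      by (intro near_add near_scale near_const ac)
    also have "(a + const_poly (- c))\<^sup>2 + (const_poly (2 * c) * a + const_poly (- (c\<^sup>2))) = a\<^sup>2"
      by (rule poly_eqI_eval) (simp add: power2_eq_square algebra_simps)
    also have "0 + (2 * c * c + - (c\<^sup>2)) = c\<^sup>2" by (simp add: power2_eq_square)
    finally show ?thesis .
  qed
  have near_mult: "near (a * b) (c * d)" if ab: "near a c" "near b d" for a b c d
  proof -
    have "near (a - b) (c - d)"
      using near_add[OF ab(1) near_minus[OF ab(2)]] by simp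
    then have "near (const_poly (1 / 4) * ((a + b)\<^sup>2 + const_poly (- 1) * (a - b)\<^sup>2))
        (1 / 4 * ((c + d)\<^sup>2 + - 1 * (c - d)\<^sup>2))"
      by (intro near_scale near_add near_square ab)
    also have "1 / 4 * ((c + d)\<^sup>2 + - 1 * (c - d)\<^sup>2) = c * d"
      by (simp add: power2_eq_square field_simps)
    finally show ?thesis by (simp only: polarization)
  qed
  have "\<forall>i :: 'n. \<exists>c. near (var_poly i) c" using near_exists by blast
  then obtain c where c: "\<And>i :: 'n. near (var_poly i) (c i)" by metis
  define x :: "real ^ 'n" where "x = vec_lambda c"
  have near_eval: "near p (eval_poly p x)" for p
  proof (induction p rule: rpoly_induct)
    case (const c) then show ?case using near_const by simp
  next
    case (var i) then show ?case using c by (simp add: x_def)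
  next
    case (add a b) then show ?case using near_add by simp
  next
    case (mult a b) then show ?case using near_mult by simp
  qed
  have "0 \<le> eval_poly q x" if "q \<in> M" for q
  proof (rule ccontr)
    assume neg: "\<not> 0 \<le> eval_poly q x"
    define e where "e = - eval_poly q x / 2"
    have "(const_poly (e + eval_poly q x) - q) + q \<in> Q"
    proof (rule qm_add[OF Q])
      have "e > 0" using neg by (simp add: e_def)
      then show "const_poly (e + eval_poly q x) - q \<in> Q"
        using near_eval[of q] unfolding near_def by blast
    qed (use that MQ in blast)
    then have "0 \<le> e + eval_poly q x" by (intro const_Q) simp
    then show False using neg by (simp add: e_def)
  qed
  then show ?thesis by blast
qed

text \<open>If \<open>f\<close> is positive wherever \<open>M\<close> is nonnegative, then adjoining \<open>- f\<close> to \<open>M\<close> leaves no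
  point, so \<open>-1\<close> has been adjoined, that is, \<open>\<sigma> f = 1 + q\<close>. Woermann's identity
  \<open>k\<^sup>2 (f + r - 1 / k) = (k - \<sigma>)\<^sup>2 (f + r) + 2 k q + r \<sigma> (2 k - \<sigma>) + (k - \<sigma>\<^sup>2 f)\<close>
  removes the denominator \<open>\<sigma>\<close>: it lowers by \<open>1 / k\<close> any \<open>r \<ge> 0\<close> for which \<open>f + r\<close> is in \<open>M\<close>,
  and some such \<open>r\<close> exists by the Archimedean property.\<close>

theorem putinar_positivstellensatz:
  fixes M :: "'n::finite rpoly set"
  assumes M: "quadratic_module M" and arch: "archimedean_module M"
    and pos: "\<And>x. \<forall>q\<in>M. 0 \<le> eval_poly q x \<Longrightarrow> 0 < eval_poly f x"
  shows "f \<in> M"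
proof -
  have "- 1 \<in> adjoin M (- f)"
  proof (rule ccontr)
    assume "- 1 \<notin> adjoin M (- f)"
    moreover have "archimedean_module (adjoin M (- f))"
      using arch adjoin_superset[of M "- f"] unfolding archimedean_module_def by blast
    ultimately obtain x where x: "\<forall>q\<in>adjoin M (- f). 0 \<le> eval_poly q x"
      using archimedean_point_exists[OF quadratic_module_adjoin[OF M]] by blast
    then have "0 < eval_poly f x" "0 \<le> eval_poly (- f) x"
      using pos adjoin_superset[of M "- f"] adjoin_member[OF M, of "- f"] by blast+
    then show False by simp
  qed
  then obtain q \<sigma> where "- 1 = q + \<sigma> * (- f)" and q: "q \<in> M" and \<sigma>: "\<sigma> \<in> sum_squares"
    unfolding adjoin_def by blast
  then have q_eq: "q = \<sigma> * f - 1" by (simp add: algebra_simps)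
  obtain N1 N2 N3 where N: "const_poly N1 - \<sigma> \<in> M" "const_poly N2 - \<sigma>\<^sup>2 * f \<in> M"
    "const_poly N3 - (- f) \<in> M"
    using arch unfolding archimedean_module_def by blast
  define k where "k = max 1 (max N1 N2)"
  have "k > 0" by (simp add: k_def)
  have raise: "const_poly c - a \<in> M" if "const_poly N - a \<in> M" "N \<le> c" for N a c
  proof -
    have "(const_poly N - a) + const_poly (c - N) \<in> M"
      using that by (intro qm_add[OF M] qm_const[OF M]) auto
    then show ?thesis by (simp add: single_diff)
  qed
  have k1: "const_poly (2 * k) - \<sigma> \<in> M" by (rule raise[OF N(1)]) (auto simp: k_def)
  have k2: "const_poly k - \<sigma>\<^sup>2 * f \<in> M" by (rule raise[OF N(2)]) (auto simp: k_def)
  have lower: "f + const_poly (r - 1 / k) \<in> M" if r: "f + const_poly r \<in> M" "0 \<le> r" for r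
  proof (rule qm_unscale[OF M])
    have "const_poly (k\<^sup>2) * (f + const_poly (r - 1 / k)) =
        (const_poly k - \<sigma>)\<^sup>2 * (f + const_poly r) + const_poly (2 * k) * q
        + const_poly r * (\<sigma> * (const_poly (2 * k) - \<sigma>)) + (const_poly k - \<sigma>\<^sup>2 * f)"
      using \<open>k > 0\<close> by (intro poly_eqI_eval) (simp add: q_eq power2_eq_square field_simps)
    also have "\<dots> \<in> M"
      using \<open>k > 0\<close> by (intro qm_add[OF M _ k2] qm_add[OF M qm_add[OF M]] qm_square_mult[OF M r(1)]
        qm_scale[OF M] q r(2) qm_sum_squares_mult[OF M k1 \<sigma>]) auto
    finally show "const_poly (k\<^sup>2) * (f + const_poly (r - 1 / k)) \<in> M" .
  qed (use \<open>k > 0\<close> in simp)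
  have descend: "f \<in> M" if "f + const_poly (real m / k) \<in> M" for m
    using that
  proof (induction m)
    case (Suc m)
    have "f + const_poly (real (Suc m) / k - 1 / k) \<in> M"
      using Suc.prems \<open>k > 0\<close> by (intro lower) auto
    then show ?case by (intro Suc.IH) (simp add: add_divide_distrib)
  qed simp
  obtain m :: nat where "N3 * k \<le> real m" using real_arch_simple by blast
  then have "N3 \<le> real m / k" using \<open>k > 0\<close> by (simp add: field_simps)
  then have "const_poly (real m / k) - (- f) \<in> M" by (rule raise[OF N(3)])
  then show ?thesis by (intro descend[of m]) (simp add: add.commute)
qed

section \<open>Degrees in sums of squares\<close>

text \<open>The homogenization of \<open>p\<close>, regarded as a polynomial of degree \<open>D\<close>, with the additional
  variable set to \<open>t\<close>.\<close>

definition homogenization_at :: "nat \<Rightarrow> 'n::finite rpoly \<Rightarrow> real ^ 'n \<Rightarrow> real \<Rightarrow> real" where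
  "homogenization_at D p x t =
     (\<Sum>\<alpha> | exp_deg \<alpha> \<le> D. mcoeff p \<alpha> * monomial_at \<alpha> x * t ^ (D - exp_deg \<alpha>))"

lemma homogenization_at_eq:
  fixes p :: "'n::finite rpoly"
  assumes "p \<in> polys_upto D" "t \<noteq> 0"
  shows "homogenization_at D p x t = t ^ D * eval_poly p ((1 / t) *\<^sub>R x)"
proof -
  have "t ^ (D - exp_deg \<alpha>) = t ^ D * (1 / t) ^ exp_deg \<alpha>" if "exp_deg \<alpha> \<le> D" for \<alpha> :: "'n \<Rightarrow>\<^sub>0 nat"
    using assms(2) that by (simp add: power_diff power_divide)
  then show ?thesis
    unfolding homogenization_at_def eval_poly_upto[OF assms(1)] sum_distrib_left
    by (intro sum.cong) (auto simp: monomial_at_scaleR)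
qed

lemma homogenization_at_tendsto:
  "(homogenization_at D p x \<longlongrightarrow> homogenization_at D p x 0) (at 0)"
proof -
  have "isCont (\<lambda>t. homogenization_at D p x t) 0"
    unfolding homogenization_at_def by (intro continuous_intros)
  then show ?thesis by (simp add: isCont_def)
qed

lemma homogenization_at_0:
  "homogenization_at D p x 0 =
     eval_poly (\<Sum>\<alpha> | exp_deg \<alpha> = D. Poly_Mapping.single \<alpha> (mcoeff p \<alpha>)) x"
proof -
  have "homogenization_at D p x 0 = (\<Sum>\<alpha> | exp_deg \<alpha> = D. mcoeff p \<alpha> * monomial_at \<alpha> x)"
    unfolding homogenization_at_def
    by (rule sum.mono_neutral_cong_right) (auto simp: finite_exp_deg_le)
  then show ?thesis by simp
qed

text \<open>The top-degree parts of the summands cannot cancel in a sum of squares.\<close>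

lemma sum_squares_drop_degree:
  assumes q: "\<And>i. i < m \<Longrightarrow> q i \<in> polys_upto (Suc D)"
    and sum: "(\<Sum>i<m. (q i)\<^sup>2) \<in> polys_upto (2 * k)" and "k \<le> D" and i: "i < (m::nat)"
  shows "q i \<in> polys_upto D"
proof -
  let ?\<sigma> = "\<Sum>i<m. (q i)\<^sup>2"
  have top0: "homogenization_at (Suc D) (q i) x 0 = 0" for x
  proof -
    \<comment> \<open>Homogenizing \<open>\<Sum>q\<^sub>i\<^sup>2\<close> to degree \<open>2 (D + 1) > 2 k\<close> leaves a positive power of \<open>t\<close>, which vanishes
      at \<open>t = 0\<close>, where the homogenizations are the top-degree parts.\<close>
    have lim1: "((\<lambda>t. \<Sum>i<m. (homogenization_at (Suc D) (q i) x t)\<^sup>2) \<longlongrightarrow>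
        (\<Sum>i<m. (homogenization_at (Suc D) (q i) x 0)\<^sup>2)) (at 0)"
      by (intro tendsto_intros homogenization_at_tendsto)
    have lim2: "((\<lambda>t. t ^ (2 * Suc D - 2 * k) * homogenization_at (2 * k) ?\<sigma> x t) \<longlongrightarrow>
        0 ^ (2 * Suc D - 2 * k) * homogenization_at (2 * k) ?\<sigma> x 0) (at 0)"
      by (intro tendsto_mult homogenization_at_tendsto tendsto_power tendsto_ident_at)
    have eq: "(\<Sum>i<m. (homogenization_at (Suc D) (q i) x t)\<^sup>2) =
        t ^ (2 * Suc D - 2 * k) * homogenization_at (2 * k) ?\<sigma> x t" if "t \<noteq> 0" for t
    proof -
      have "(\<Sum>i<m. (homogenization_at (Suc D) (q i) x t)\<^sup>2) =
          (\<Sum>i<m. t ^ (2 * Suc D) * (eval_poly (q i) ((1 / t) *\<^sub>R x))\<^sup>2)"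
        using that q by (intro sum.cong) (simp_all add: homogenization_at_eq power_mult_distrib power_mult[symmetric] mult.commute
            del: power_Suc)
      also have "\<dots> = t ^ (2 * Suc D) * eval_poly ?\<sigma> ((1 / t) *\<^sub>R x)"
        by (simp add: sum_distrib_left)
      also have "t ^ (2 * Suc D) = t ^ (2 * Suc D - 2 * k) * t ^ (2 * k)"
        using \<open>k \<le> D\<close> by (simp flip: power_add)
      finally show ?thesis
        using that by (simp add: homogenization_at_eq[OF sum] mult.assoc)
    qed
    have "((\<lambda>t. t ^ (2 * Suc D - 2 * k) * homogenization_at (2 * k) ?\<sigma> x t) \<longlongrightarrow>
        (\<Sum>i<m. (homogenization_at (Suc D) (q i) x 0)\<^sup>2)) (at 0)"
      by (rule Lim_transform_eventually[OF lim1]) (auto simp: eventually_at_filter eq)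
    from LIM_unique[OF this lim2] have "(\<Sum>i<m. (homogenization_at (Suc D) (q i) x 0)\<^sup>2) =
        0 ^ (2 * Suc D - 2 * k) * homogenization_at (2 * k) ?\<sigma> x 0" .
    then have "(\<Sum>i<m. (homogenization_at (Suc D) (q i) x 0)\<^sup>2) = 0"
      using \<open>k \<le> D\<close> by simp
    then show ?thesis using i by (simp add: sum_nonneg_eq_0_iff)
  qed
  have "(\<Sum>\<alpha> | exp_deg \<alpha> = Suc D. Poly_Mapping.single \<alpha> (mcoeff (q i) \<alpha>)) = 0"
    by (rule poly_eqI_eval) (metis top0 homogenization_at_0 eval_poly_0)
  then have top: "mcoeff (\<Sum>\<alpha> | exp_deg \<alpha> = Suc D. Poly_Mapping.single \<alpha> (mcoeff (q i) \<alpha>)) \<beta> = 0" for \<beta>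
    by simp
  have fin: "finite {\<alpha> :: 'a \<Rightarrow>\<^sub>0 nat. exp_deg \<alpha> = Suc D}"
    by (rule finite_subset[OF _ finite_exp_deg_le[of "Suc D"]]) auto
  have "mcoeff (q i) \<beta> = 0" if "exp_deg \<beta> = Suc D" for \<beta>
    using top[of \<beta>] that fin by (simp add: lookup_sum lookup_single when_def)
  then show ?thesis using q[OF i] unfolding polys_upto_def by (auto simp: le_Suc_eq)
qed

lemma sum_squares_summand_degree:
  assumes sum: "(\<Sum>i<m. (q i)\<^sup>2) \<in> polys_upto (2 * k)" and i: "i < (m::nat)"
  shows "q i \<in> polys_upto k"
proof -
  have "\<forall>j. \<exists>D. q j \<in> polys_upto D" using polys_upto_exists by blast
  then obtain D where D: "\<And>j. q j \<in> polys_upto (D j)" by metis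
  have "\<forall>j<m. q j \<in> polys_upto (k + Max (D ` {..<m}))"
    using D by (auto intro!: polys_upto_mono[OF D] trans_le_add2 Max_ge)
  moreover have "\<forall>j<m. q j \<in> polys_upto k" if "\<forall>j<m. q j \<in> polys_upto (k + e)" for e
    using that
  proof (induction e)
    case (Suc e)
    then have "\<forall>j<m. q j \<in> polys_upto (k + e)"
      using sum_squares_drop_degree[of m q "k + e" k, OF _ sum] by simp
    then show ?case by (rule Suc.IH)
  qed simp
  ultimately show ?thesis using i by blast
qed

section \<open>Gram matrices\<close>

lemma sum_squares_iff: "\<sigma> \<in> sum_squares \<longleftrightarrow> (\<exists>(m::nat) q. \<sigma> = (\<Sum>i<m. (q i)\<^sup>2))"
proof
  show "\<exists>(m::nat) q. \<sigma> = (\<Sum>i<m. (q i)\<^sup>2)" if "\<sigma> \<in> sum_squares"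
    using that
  proof induction
    case zero
    show ?case by (intro exI[of _ 0]) simp
  next
    case (add_square a p)
    then obtain m :: nat and q where "a = (\<Sum>i<m. (q i)\<^sup>2)" by blast
    then have "p\<^sup>2 + a = (\<Sum>i<Suc m. ((q(m := p)) i)\<^sup>2)" by simp
    then show ?case by blast
  qed
next
  have "(\<Sum>i<m. (q i)\<^sup>2) \<in> sum_squares" for m :: nat and q
    by (induction m) (auto simp: add.commute intro: sum_squares.intros)
  then show "\<sigma> \<in> sum_squares" if "\<exists>(m::nat) q. \<sigma> = (\<Sum>i<m. (q i)\<^sup>2)"
    using that by blast
qed

lemma double_sum_insert:
  fixes H :: "'b \<Rightarrow> 'b \<Rightarrow> 'c::comm_monoid_add"
  assumes "finite B" "a \<notin> B"
  shows "(\<Sum>x\<in>insert a B. \<Sum>y\<in>insert a B. H x y) =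
      H a a + (\<Sum>y\<in>B. H a y) + ((\<Sum>x\<in>B. H x a) + (\<Sum>x\<in>B. \<Sum>y\<in>B. H x y))"
  using assms by (simp add: sum.distrib ac_simps)

text \<open>A positive semidefinite form is diagonalized by completing squares, one variable at a
  time.\<close>

lemma psd_form_sum_squares:
  fixes X :: "'b \<Rightarrow> 'n::finite rpoly" and G :: "'b \<Rightarrow> 'b \<Rightarrow> real"
  assumes "finite B" and "\<And>a b. G a b = G b a"
    and "\<And>v. 0 \<le> (\<Sum>a\<in>B. \<Sum>b\<in>B. G a b * v a * v b)"
  shows "(\<Sum>a\<in>B. \<Sum>b\<in>B. const_poly (G a b) * X a * X b) \<in> sum_squares"
  using assms
proof (induction B arbitrary: G)
  case empty
  then show ?case by (simp add: sum_squares.zero)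
next
  case (insert a B)
  note sym = insert.prems(1)
  have form: "0 \<le> G a a * v a * v a + 2 * v a * (\<Sum>b\<in>B. G a b * v b) + (\<Sum>x\<in>B. \<Sum>y\<in>B. G x y * v x * v y)"
    for v
  proof -
    have "(\<Sum>b\<in>B. G b a * v b * v a) = v a * (\<Sum>b\<in>B. G a b * v b)"
      "(\<Sum>b\<in>B. G a b * v a * v b) = v a * (\<Sum>b\<in>B. G a b * v b)"
      by (simp_all add: sum_distrib_left sym[of _ a] ac_simps)
    then show ?thesis
      using insert.prems(2)[of v] unfolding double_sum_insert[OF insert.hyps(1,2)] by simp
  qed
  define S where "S = (\<Sum>b\<in>B. const_poly (G a b) * X b)"
  have poly: "(\<Sum>x\<in>insert a B. \<Sum>y\<in>insert a B. const_poly (G x y) * X x * X y) =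
      const_poly (G a a) * X a * X a + X a * S + X a * S + (\<Sum>x\<in>B. \<Sum>y\<in>B. const_poly (G x y) * X x * X y)"
  proof -
    have "(\<Sum>b\<in>B. const_poly (G b a) * X b * X a) = X a * S"
      "(\<Sum>b\<in>B. const_poly (G a b) * X a * X b) = X a * S"
      by (simp_all add: S_def sum_distrib_left sym[of _ a] ac_simps)
    then show ?thesis
      unfolding double_sum_insert[OF insert.hyps(1,2)] by (simp add: add.assoc)
  qed
  have diag: "0 \<le> G a a"
  proof -
    have "(\<Sum>b\<in>B. G a b * (if b = a then 1 else 0)) = 0"
      "(\<Sum>x\<in>B. \<Sum>y\<in>B. G x y * (if x = a then 1 else 0) * (if y = a then 1 else 0)) = 0"
      using insert.hyps(2) by (auto intro!: sum.neutral)
    then show ?thesis using form[of "\<lambda>x. if x = a then 1 else 0"] by simp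
  qed
  show ?case
  proof (cases "G a a = 0")
    case True
    have zero: "G a b = 0" if b: "b \<in> B" for b
    proof (rule ccontr)
      assume nz: "G a b \<noteq> 0"
      \<comment> \<open>with this \<open>t\<close> the form takes the value \<open>-1\<close> at \<open>t e\<^sub>a + e\<^sub>b\<close>\<close>
      define t where "t = - (G b b + 1) / (2 * G a b)"
      define v where "v x = (if x = a then t else if x = b then 1 else 0)" for x
      have "b \<noteq> a" using b insert.hyps by blast
      have vB: "v x = (if x = b then 1 else 0)" if "x \<in> B" for x
        using that insert.hyps(2) by (auto simp: v_def)
      have "(\<Sum>x\<in>B. G a x * v x) = (\<Sum>x\<in>B. if x = b then G a x else 0)"
        by (intro sum.cong) (auto simp: vB)
      also have "\<dots> = G a b" using b insert.hyps(1) by simp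
      finally have 1: "(\<Sum>x\<in>B. G a x * v x) = G a b" .
      have "(\<Sum>x\<in>B. \<Sum>y\<in>B. G x y * v x * v y) = (\<Sum>x\<in>B. \<Sum>y\<in>B. if y = b then if x = b then G x y else 0 else 0)"
        by (intro sum.cong refl) (auto simp: vB)
      also have "\<dots> = G b b" using b insert.hyps(1) by simp
      finally have 2: "(\<Sum>x\<in>B. \<Sum>y\<in>B. G x y * v x * v y) = G b b" .
      have "0 \<le> 2 * t * G a b + G b b"
        using form[of v] unfolding 1 2 using True by (simp add: v_def)
      also have "\<dots> = - 1" using nz by (simp add: t_def field_simps)
      finally show False by simp
    qed
    have "(\<Sum>x\<in>B. \<Sum>y\<in>B. const_poly (G x y) * X x * X y) \<in> sum_squares"
    proof (rule insert.IH[OF sym])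
      show "0 \<le> (\<Sum>x\<in>B. \<Sum>y\<in>B. G x y * v x * v y)" for v
        using form[of v] True zero by simp
    qed
    moreover have "S = 0" unfolding S_def by (rule sum.neutral) (simp add: zero)
    ultimately show ?thesis unfolding poly using True by simp
  next
    case False
    define g where "g = G a a"
    have "g > 0" using False diag by (simp add: g_def)
    define G' where "G' x y = G x y - G a x * G a y / g" for x y
    have rest: "(\<Sum>x\<in>B. \<Sum>y\<in>B. const_poly (G' x y) * X x * X y) \<in> sum_squares"
    proof (rule insert.IH)
      show "G' x y = G' y x" for x y unfolding G'_def using sym[of x y] by simp
    next
      fix v
      define u where "u = (\<Sum>b\<in>B. G a b * v b)"
      define v' where "v' = v(a := - u / g)"
      have *: "(\<Sum>b\<in>B. G a b * v' b) = u"
        "(\<Sum>x\<in>B. \<Sum>y\<in>B. G x y * v' x * v' y) = (\<Sum>x\<in>B. \<Sum>y\<in>B. G x y * v x * v y)"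
        unfolding u_def v'_def using insert.hyps(2) by (auto intro!: sum.cong)
      have "0 \<le> (\<Sum>x\<in>B. \<Sum>y\<in>B. G x y * v x * v y) - u * u / g"
        using form[of v'] \<open>g > 0\<close> unfolding * by (simp add: v'_def g_def[symmetric] field_simps)
      also have "u * u / g = (\<Sum>x\<in>B. \<Sum>y\<in>B. G a x * G a y / g * v x * v y)"
        unfolding u_def sum_product sum_divide_distrib by (intro sum.cong refl) (simp add: field_simps)
      finally show "0 \<le> (\<Sum>x\<in>B. \<Sum>y\<in>B. G' x y * v x * v y)"
        by (simp add: G'_def left_diff_distrib sum_subtractf)
    qed
    have completed: "(const_poly (sqrt (1 / g)) * (const_poly g * X a + S))\<^sup>2 +
        (\<Sum>x\<in>B. \<Sum>y\<in>B. const_poly (G' x y) * X x * X y) =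
        (\<Sum>x\<in>insert a B. \<Sum>y\<in>insert a B. const_poly (G x y) * X x * X y)"
      unfolding poly
    proof (rule poly_eqI_eval)
      fix x :: "real ^ 'n"
      let ?e = "\<lambda>p :: 'n rpoly. eval_poly p x"
      have sq: "?e S * ?e S / g = (\<Sum>b\<in>B. \<Sum>c\<in>B. G a b * G a c / g * ?e (X b) * ?e (X c))"
        unfolding S_def eval_poly_sum sum_product sum_divide_distrib
        by (intro sum.cong refl) (simp add: field_simps)
      have "?e ((const_poly (sqrt (1 / g)) * (const_poly g * X a + S))\<^sup>2) = (g * ?e (X a) + ?e S)\<^sup>2 / g"
        using \<open>g > 0\<close> by (simp add: power_mult_distrib)
      also have "\<dots> = g * ?e (X a) * ?e (X a) + 2 * ?e (X a) * ?e S + ?e S * ?e S / g"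
        using \<open>g > 0\<close> by (simp add: power2_eq_square field_simps)
      finally have "?e ((const_poly (sqrt (1 / g)) * (const_poly g * X a + S))\<^sup>2) = 
        g * ?e (X a) * ?e (X a) + 2 * ?e (X a) * ?e S + ?e S * ?e S / g" .
      then show "?e ((const_poly (sqrt (1 / g)) * (const_poly g * X a + S))\<^sup>2 +
          (\<Sum>x\<in>B. \<Sum>y\<in>B. const_poly (G' x y) * X x * X y)) =
          ?e (const_poly (G a a) * X a * X a + X a * S + X a * S + (\<Sum>x\<in>B. \<Sum>y\<in>B. const_poly (G x y) * X x * X y))"
        unfolding sq by (simp add: G'_def g_def[symmetric] left_diff_distrib sum_subtractf)
    qed
    show ?thesis unfolding completed[symmetric] by (rule sum_squares.add_square[OF rest])
  qed
qed

section \<open>The truncated cones are closed\<close>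

lemma sos_nonneg_iff: "0 \<le> k \<Longrightarrow> \<sigma> \<in> sos k \<longleftrightarrow> \<sigma> \<in> polys_upto (2 * nat k) \<and> \<sigma> \<in> sum_squares"
  by (auto simp: sos_def sum_squares_iff)

lemma sos_upto: "\<sigma> \<in> sos k \<Longrightarrow> \<sigma> \<in> polys_upto (2 * nat k)"
  by (auto simp: sos_def split: if_splits)

lemma sos_sum_squares: "\<sigma> \<in> sos k \<Longrightarrow> \<sigma> \<in> sum_squares"
  by (cases "0 \<le> k") (simp add: sos_nonneg_iff, simp add: sos_def sum_squares.zero)

lemma zero_in_sos [simp]: "0 \<in> sos k"
  by (cases "0 \<le> k") (simp add: sos_nonneg_iff sum_squares.zero, simp add: sos_def)

lemma eval_sos_nonneg: "\<sigma> \<in> sos k \<Longrightarrow> 0 \<le> eval_poly \<sigma> x"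
  using sos_sum_squares[of \<sigma> k] by (auto simp: sum_squares_iff intro!: sum_nonneg)

text \<open>The Gram matrices of the members of a convergent sequence are bounded, because their
  diagonal entries are sums of squared coefficients, which point values of the polynomials control. A limit
  of Gram matrices is positive semidefinite, hence again a sum of squares.\<close>

lemma sos_closed:
  fixes \<sigma> :: "nat \<Rightarrow> 'n::finite rpoly"
  assumes \<sigma>: "\<And>m. \<sigma> m \<in> sos k" and l: "l \<in> polys_upto (2 * nat k)"
    and lim: "\<And>\<alpha>. (\<lambda>m. mcoeff (\<sigma> m) \<alpha>) \<longlonglongrightarrow> mcoeff l \<alpha>"
  shows "l \<in> sos k"
proof (cases "0 \<le> k")
  case False
  then have "\<sigma> m = 0" for m using \<sigma>[of m] by (simp add: sos_def)
  then have "l = 0"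
    using lim by (auto intro!: poly_mapping_eqI simp: LIMSEQ_const_iff)
  then show ?thesis by simp
next
  case True
  define D where "D = nat k"
  let ?E = "{\<alpha> :: 'n \<Rightarrow>\<^sub>0 nat. exp_deg \<alpha> \<le> D}"
  have "\<forall>m. \<exists>(n::nat) q. \<sigma> m = (\<Sum>i<n. (q i)\<^sup>2)"
    using \<sigma> sos_sum_squares sum_squares_iff by metis
  then obtain n :: "nat \<Rightarrow> nat" and q where q: "\<And>m. \<sigma> m = (\<Sum>i<n m. (q m i)\<^sup>2)" by metis
  have qD: "q m i \<in> polys_upto D" if "i < n m" for m i
    using sum_squares_summand_degree[of "q m" "n m" D i] that sos_upto[OF \<sigma>[of m]] by (simp add: q D_def)
  define G where "G m \<alpha> \<beta> = (\<Sum>i<n m. mcoeff (q m i) \<alpha> * mcoeff (q m i) \<beta>)" for m \<alpha> \<beta>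
  have psd: "(\<Sum>\<alpha>\<in>?E. \<Sum>\<beta>\<in>?E. G m \<alpha> \<beta> * v \<alpha> * v \<beta>) = (\<Sum>i<n m. (\<Sum>\<alpha>\<in>?E. mcoeff (q m i) \<alpha> * v \<alpha>)\<^sup>2)"
    for m v
  proof -
    have "(\<Sum>\<alpha>\<in>?E. \<Sum>\<beta>\<in>?E. G m \<alpha> \<beta> * v \<alpha> * v \<beta>) =
        (\<Sum>\<alpha>\<in>?E. \<Sum>\<beta>\<in>?E. \<Sum>i<n m. (mcoeff (q m i) \<alpha> * v \<alpha>) * (mcoeff (q m i) \<beta> * v \<beta>))"
      unfolding G_def sum_distrib_right by (intro sum.cong refl) (simp add: ac_simps)
    also have "\<dots> = (\<Sum>i<n m. \<Sum>\<alpha>\<in>?E. \<Sum>\<beta>\<in>?E. (mcoeff (q m i) \<alpha> * v \<alpha>) * (mcoeff (q m i) \<beta> * v \<beta>))"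
      by (subst sum.swap[of _ "{..<n m}" ?E], subst sum.swap[of _ "{..<n m}" ?E]) simp
    finally show ?thesis by (simp add: power2_eq_square sum_product)
  qed
  have eval_\<sigma>: "eval_poly (\<sigma> m) x = (\<Sum>\<alpha>\<in>?E. \<Sum>\<beta>\<in>?E. G m \<alpha> \<beta> * monomial_at \<alpha> x * monomial_at \<beta> x)" for m x
    unfolding psd q eval_poly_sum eval_poly_power
    by (intro sum.cong refl arg_cong[of _ _ "\<lambda>t. t\<^sup>2"] eval_poly_upto qD) simp
  have lim_eval: "(\<lambda>m. eval_poly (\<sigma> m) x) \<longlonglongrightarrow> eval_poly l x" for x
    by (rule eval_poly_tendsto[OF sos_upto[OF \<sigma>] l lim])
  have diag: "\<exists>C. \<forall>m. G m \<alpha> \<alpha> \<le> C" for \<alpha>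
  proof -
    obtain P c where P: "finite P"
      "\<And>p. p \<in> polys_upto D \<Longrightarrow> mcoeff p \<alpha> = (\<Sum>x\<in>P. c x * eval_poly p x)"
      using coefficient_functional[of "UNIV :: (real ^ 'n) set" D \<alpha>] by auto
    have "G m \<alpha> \<alpha> \<le> (\<Sum>x\<in>P. (c x)\<^sup>2) * (\<Sum>x\<in>P. eval_poly (\<sigma> m) x)" for m
    proof -
      have "G m \<alpha> \<alpha> = (\<Sum>i<n m. (\<Sum>x\<in>P. c x * eval_poly (q m i) x)\<^sup>2)"
        unfolding G_def by (intro sum.cong refl) (simp add: P(2)[OF qD] power2_eq_square)
      also have "\<dots> \<le> (\<Sum>i<n m. (\<Sum>x\<in>P. (c x)\<^sup>2) * (\<Sum>x\<in>P. (eval_poly (q m i) x)\<^sup>2))"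
        by (intro sum_mono Cauchy_Schwarz_ineq_sum)
      also have "\<dots> = (\<Sum>x\<in>P. (c x)\<^sup>2) * (\<Sum>x\<in>P. eval_poly (\<sigma> m) x)"
        unfolding q eval_poly_sum eval_poly_power sum_distrib_left[symmetric] by (subst sum.swap) simp
      finally show ?thesis .
    qed
    moreover have "(\<lambda>m. (\<Sum>x\<in>P. (c x)\<^sup>2) * (\<Sum>x\<in>P. eval_poly (\<sigma> m) x)) \<longlonglongrightarrow>
        (\<Sum>x\<in>P. (c x)\<^sup>2) * (\<Sum>x\<in>P. eval_poly l x)"
      by (intro tendsto_intros lim_eval)
    then have "Bseq (\<lambda>m. (\<Sum>x\<in>P. (c x)\<^sup>2) * (\<Sum>x\<in>P. eval_poly (\<sigma> m) x))"
      by (meson convergentI convergent_imp_Bseq)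
    then obtain C where "\<forall>m. norm ((\<Sum>x\<in>P. (c x)\<^sup>2) * (\<Sum>x\<in>P. eval_poly (\<sigma> m) x)) \<le> C"
      by (meson BseqE)
    ultimately have "G m \<alpha> \<alpha> \<le> C" for m
      by (metis abs_le_D1 order_trans real_norm_def)
    then show ?thesis by blast
  qed
  have "\<exists>C. \<forall>m. \<bar>G m \<alpha> \<beta>\<bar> \<le> C" for \<alpha> \<beta>
  proof -
    obtain C1 C2 where C: "\<And>m. G m \<alpha> \<alpha> \<le> C1" "\<And>m. G m \<beta> \<beta> \<le> C2" using diag by metis
    have "\<bar>G m \<alpha> \<beta>\<bar> \<le> C1 + C2" for m
    proof -
      have "\<bar>a * b\<bar> \<le> a * a + b * b" for a b :: real
      proof -
        have "2 * (a * b) \<le> a * a + b * b" "- 2 * (a * b) \<le> a * a + b * b"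
          using zero_le_square[of "a - b"] zero_le_square[of "a + b"] by (simp_all add: algebra_simps)
        then show ?thesis using zero_le_square[of a] zero_le_square[of b] by linarith
      qed
      then have "\<bar>G m \<alpha> \<beta>\<bar> \<le> G m \<alpha> \<alpha> + G m \<beta> \<beta>"
        unfolding G_def sum.distrib[symmetric] by (intro order_trans[OF sum_abs] sum_mono)
      then show ?thesis using C[of m] by linarith
    qed
    then show ?thesis by blast
  qed
  then obtain r L where r: "strict_mono (r :: nat \<Rightarrow> nat)"
    and L: "\<forall>a\<in>?E \<times> ?E. (\<lambda>m. G (r m) (fst a) (snd a)) \<longlonglongrightarrow> L a"
    using common_convergent_subsequence[of "?E \<times> ?E" "\<lambda>m a. G m (fst a) (snd a)"] finite_exp_deg_le
    by blast
  define G' where "G' \<alpha> \<beta> = (if \<alpha> \<in> ?E \<and> \<beta> \<in> ?E then L (\<alpha>, \<beta>) else 0)" for \<alpha> \<beta>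
  have G': "(\<lambda>m. G (r m) \<alpha> \<beta>) \<longlonglongrightarrow> G' \<alpha> \<beta>" if "\<alpha> \<in> ?E" "\<beta> \<in> ?E" for \<alpha> \<beta>
    using L that by (force simp: G'_def)
  have sym: "G' \<alpha> \<beta> = G' \<beta> \<alpha>" for \<alpha> \<beta>
  proof (cases "\<alpha> \<in> ?E \<and> \<beta> \<in> ?E")
    case True
    have "G m \<alpha> \<beta> = G m \<beta> \<alpha>" for m by (simp add: G_def mult.commute)
    then show ?thesis using G'[of \<alpha> \<beta>] G'[of \<beta> \<alpha>] True LIMSEQ_unique by auto
  qed (auto simp: G'_def)
  have form_lim: "(\<lambda>m. \<Sum>\<alpha>\<in>?E. \<Sum>\<beta>\<in>?E. G (r m) \<alpha> \<beta> * v \<alpha> * v \<beta>) \<longlonglongrightarrow>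
      (\<Sum>\<alpha>\<in>?E. \<Sum>\<beta>\<in>?E. G' \<alpha> \<beta> * v \<alpha> * v \<beta>)" for v
    by (intro tendsto_sum tendsto_mult tendsto_const G')
  have "0 \<le> (\<Sum>\<alpha>\<in>?E. \<Sum>\<beta>\<in>?E. G' \<alpha> \<beta> * v \<alpha> * v \<beta>)" for v
    by (rule LIMSEQ_le_const[OF form_lim]) (auto simp: psd intro!: sum_nonneg)
  then have "(\<Sum>\<alpha>\<in>?E. \<Sum>\<beta>\<in>?E. const_poly (G' \<alpha> \<beta>) * Poly_Mapping.single \<alpha> 1 * Poly_Mapping.single \<beta> 1)
      \<in> sum_squares"
    by (intro psd_form_sum_squares finite_exp_deg_le sym)
  moreover have "l = (\<Sum>\<alpha>\<in>?E. \<Sum>\<beta>\<in>?E. const_poly (G' \<alpha> \<beta>) * Poly_Mapping.single \<alpha> 1 * Poly_Mapping.single \<beta> 1)"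
  proof (rule poly_eqI_eval)
    fix x
    have "(\<lambda>m. eval_poly (\<sigma> (r m)) x) \<longlonglongrightarrow> eval_poly l x"
      using LIMSEQ_subseq_LIMSEQ[OF lim_eval r] by (simp add: o_def)
    then show "eval_poly l x =
        eval_poly (\<Sum>\<alpha>\<in>?E. \<Sum>\<beta>\<in>?E. const_poly (G' \<alpha> \<beta>) * Poly_Mapping.single \<alpha> 1 * Poly_Mapping.single \<beta> 1) x"
      using form_lim[of "\<lambda>\<alpha>. monomial_at \<alpha> x"] LIMSEQ_unique by (force simp: eval_\<sigma>)
  qed
  ultimately show ?thesis using True l by (simp add: sos_nonneg_iff)
qed

lemma half_deg_nonneg: "0 \<le> half_deg p"
  by (simp add: half_deg_def)

lemma common_nonvanishing_point:
  fixes U :: "(real ^ 'n::finite) set"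
  assumes "finite J" "open U" "U \<noteq> {}" "\<And>j. j \<in> J \<Longrightarrow> w j \<noteq> 0"
  shows "{x \<in> U. \<forall>j\<in>J. eval_poly (w j) x \<noteq> 0} \<noteq> {} \<and> open {x \<in> U. \<forall>j\<in>J. eval_poly (w j) x \<noteq> 0}"
  using assms(1,4)
proof (induction J)
  case empty
  then show ?case using assms by simp
next
  case (insert a J)
  let ?V = "{x \<in> U. \<forall>j\<in>J. eval_poly (w j) x \<noteq> 0}"
  have V: "?V \<noteq> {}" "open ?V" using insert by auto
  have eq: "{x \<in> U. \<forall>j\<in>insert a J. eval_poly (w j) x \<noteq> 0} = {x \<in> ?V. eval_poly (w a) x \<noteq> 0}"
    by auto
  have "\<exists>x\<in>?V. eval_poly (w a) x \<noteq> 0"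
    using poly_eq_0_if_vanishes_on_open[OF V(2,1), of "w a"] insert.prems by blast
  moreover have "open (?V \<inter> (eval_poly (w a) -` (- {0})))"
    by (rule continuous_open_preimage[OF continuous_on_eval_poly V(2)]) auto
  moreover have "?V \<inter> (eval_poly (w a) -` (- {0})) = {x \<in> ?V. eval_poly (w a) x \<noteq> 0}" by auto
  ultimately show ?case unfolding eq by auto
qed

text \<open>At an interior point of \<open>K\<close> where no nonzero \<open>w\<^sub>j\<close> vanishes, each term of \<open>\<Sum>\<sigma>\<^sub>j w\<^sub>j\<close> is
  bounded by the sum, so the multipliers of a convergent sequence are bounded there.\<close>

lemma sos_cone_closed:
  fixes w :: "nat \<Rightarrow> 'n::finite rpoly"
  assumes int: "interior {x. \<forall>j\<in>{0..s}. 0 \<le> eval_poly (w j) x} \<noteq> {}"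
    and p: "\<And>m. p m \<in> sos_cone w s k" "\<And>m. p m \<in> polys_upto D" and l: "l \<in> polys_upto D"
    and lim: "\<And>\<alpha>. (\<lambda>m. mcoeff (p m) \<alpha>) \<longlonglongrightarrow> mcoeff l \<alpha>"
  shows "l \<in> sos_cone w s k"
proof -
  let ?K = "{x. \<forall>j\<in>{0..s}. 0 \<le> eval_poly (w j) x}"
  define h where "h j = int k - half_deg (w j)" for j
  define J where "J = {j \<in> {0..s}. w j \<noteq> 0}"
  define V where "V = {x \<in> interior ?K. \<forall>j\<in>J. eval_poly (w j) x \<noteq> 0}"
  have "V \<noteq> {} \<and> open V"
    unfolding V_def by (rule common_nonvanishing_point[OF _ open_interior int]) (simp_all add: J_def)
  then have V: "V \<noteq> {}" "open V" by blast+
  have "\<forall>m. \<exists>\<sigma>. p m = (\<Sum>j=0..s. \<sigma> j * w j) \<and> (\<forall>j\<in>{0..s}. \<sigma> j \<in> sos (h j))"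
    using p(1) unfolding sos_cone_def h_def by auto
  then obtain \<sigma> where "\<forall>m. p m = (\<Sum>j=0..s. \<sigma> m j * w j) \<and> (\<forall>j\<in>{0..s}. \<sigma> m j \<in> sos (h j))"
    by (rule choice[THEN exE])
  then have \<sigma>: "\<And>m. p m = (\<Sum>j=0..s. \<sigma> m j * w j)" "\<And>m j. j \<in> {0..s} \<Longrightarrow> \<sigma> m j \<in> sos (h j)"
    by blast+
  have p_J: "p m = (\<Sum>j\<in>J. \<sigma> m j * w j)" for m
    unfolding \<sigma>(1) by (rule sum.mono_neutral_right) (auto simp: J_def)
  have lim_eval: "(\<lambda>m. eval_poly (p m) x) \<longlonglongrightarrow> eval_poly l x" for x
    by (rule eval_poly_tendsto[OF p(2) l lim])
  have upto: "\<sigma> m j \<in> polys_upto (2 * k)" if "j \<in> J" for m j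
  proof (rule polys_upto_mono)
    show "\<sigma> m j \<in> polys_upto (2 * nat (h j))" using that by (intro sos_upto \<sigma>(2)) (simp add: J_def)
    show "2 * nat (h j) \<le> 2 * k" using half_deg_nonneg[of "w j"] by (simp add: h_def)
  qed
  have "\<exists>C. \<forall>m. \<bar>eval_poly (\<sigma> m j) x\<bar> \<le> C" if j: "j \<in> J" and x: "x \<in> V" for j x
  proof -
    have "x \<in> ?K" using x interior_subset[of ?K] unfolding V_def by blast
    then have w_nonneg: "\<And>i. i \<in> J \<Longrightarrow> 0 \<le> eval_poly (w i) x" by (simp add: J_def)
    have "eval_poly (w j) x \<noteq> 0" using x j by (simp add: V_def)
    then have w_pos: "0 < eval_poly (w j) x" using w_nonneg[OF j] by simp
    obtain C where C: "\<And>m. \<bar>eval_poly (p m) x\<bar> \<le> C"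
      using lim_eval[of x] by (metis BseqE convergentI convergent_imp_Bseq real_norm_def)
    have "\<bar>eval_poly (\<sigma> m j) x\<bar> \<le> C / eval_poly (w j) x" for m
    proof -
      have nonneg: "\<And>i. i \<in> J \<Longrightarrow> 0 \<le> eval_poly (\<sigma> m i) x"
        using \<sigma>(2) by (auto simp: J_def intro: eval_sos_nonneg)
      have "eval_poly (\<sigma> m j) x * eval_poly (w j) x \<le> (\<Sum>i\<in>J. eval_poly (\<sigma> m i) x * eval_poly (w i) x)"
        using j nonneg w_nonneg by (intro member_le_sum[where f = "\<lambda>i. eval_poly (\<sigma> m i) x * eval_poly (w i) x"])
          (simp_all add: J_def)
      also have "\<dots> = eval_poly (p m) x" by (simp add: p_J)
      also have "\<dots> \<le> C" using C[of m] by linarith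
      finally show ?thesis using w_pos nonneg[OF j] by (simp add: field_simps)
    qed
    then show ?thesis by blast
  qed
  then have "\<exists>(r :: nat \<Rightarrow> nat) q. strict_mono r \<and> (\<forall>j. q j \<in> polys_upto (2 * k)) \<and>
      (\<forall>j\<in>J. \<forall>\<alpha>. (\<lambda>m. mcoeff (\<sigma> (r m) j) \<alpha>) \<longlonglongrightarrow> mcoeff (q j) \<alpha>)"
    by (intro pointwise_bounded_polys_subsequence[OF V(2,1)] upto) (simp add: J_def)
  then obtain r q where r: "strict_mono (r :: nat \<Rightarrow> nat)" and q: "\<And>j. q j \<in> polys_upto (2 * k)"
    and q_lim: "\<And>j \<alpha>. j \<in> J \<Longrightarrow> (\<lambda>m. mcoeff (\<sigma> (r m) j) \<alpha>) \<longlonglongrightarrow> mcoeff (q j) \<alpha>"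
    by metis
  have q_sos: "q j \<in> sos (h j)" if j: "j \<in> J" for j
  proof (rule sos_closed)
    show s: "\<sigma> (r m) j \<in> sos (h j)" for m using \<sigma>(2) j by (auto simp: J_def)
    have "mcoeff (q j) \<alpha> = 0" if "\<not> exp_deg \<alpha> \<le> 2 * nat (h j)" for \<alpha>
    proof -
      have "mcoeff (\<sigma> (r m) j) \<alpha> = 0" for m using sos_upto[OF s] that by (auto simp: polys_upto_def)
      then show ?thesis using q_lim[OF j, of \<alpha>] by (simp add: LIMSEQ_const_iff)
    qed
    then show "q j \<in> polys_upto (2 * nat (h j))" by (auto simp: polys_upto_def)
  qed (rule q_lim[OF j])
  have "l = (\<Sum>j\<in>J. q j * w j)"
  proof (rule poly_eqI_eval)
    fix x
    have "(\<lambda>m. eval_poly (p (r m)) x) \<longlonglongrightarrow> eval_poly l x"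
      using LIMSEQ_subseq_LIMSEQ[OF lim_eval r] by (simp add: o_def)
    moreover have "(\<lambda>m. \<Sum>j\<in>J. eval_poly (\<sigma> (r m) j) x * eval_poly (w j) x) \<longlonglongrightarrow>
        (\<Sum>j\<in>J. eval_poly (q j) x * eval_poly (w j) x)"
      by (intro tendsto_sum tendsto_mult tendsto_const eval_poly_tendsto[OF upto q q_lim])
    ultimately show "eval_poly l x = eval_poly (\<Sum>j\<in>J. q j * w j) x"
      by (simp add: p_J LIMSEQ_unique)
  qed
  also have "\<dots> = (\<Sum>j=0..s. (if j \<in> J then q j else 0) * w j)"
    by (rule sum.mono_neutral_cong_left) (auto simp: J_def)
  finally show ?thesis
    unfolding sos_cone_def using q_sos by (auto simp: h_def intro!: exI[of _ "\<lambda>j. if j \<in> J then q j else 0"])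
qed

section \<open>The union of the truncated cones\<close>

lemma sos_add: "\<sigma> \<in> sos k \<Longrightarrow> \<tau> \<in> sos k \<Longrightarrow> \<sigma> + \<tau> \<in> sos k"
  by (cases "0 \<le> k")
    (auto simp: sos_nonneg_iff intro: polys_upto_add sum_squares_add, auto simp: sos_def)

lemma sos_mono: "\<sigma> \<in> sos k \<Longrightarrow> k \<le> l \<Longrightarrow> \<sigma> \<in> sos l"
  by (cases "0 \<le> k")
    (auto simp: sos_nonneg_iff elim: polys_upto_mono, auto simp: sos_def[of k])

lemma sos_square_mult:
  assumes "\<sigma> \<in> sos k" "b \<in> polys_upto e"
  shows "b\<^sup>2 * \<sigma> \<in> sos (k + int e)"
proof (cases "0 \<le> k")
  case True
  have "b\<^sup>2 * \<sigma> \<in> polys_upto (2 * e + 2 * nat k)"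
    using assms by (intro polys_upto_mult polys_upto_power2 sos_upto)
  then show ?thesis
    using True sum_squares_square_mult[OF sos_sum_squares[OF assms(1)]]
    by (simp add: sos_nonneg_iff nat_add_distrib add.commute)
next
  case False
  then show ?thesis using assms by (simp add: sos_def[of k])
qed

lemma sos_coneI:
  "(\<And>j. j \<in> {0..s} \<Longrightarrow> \<sigma> j \<in> sos (int k - half_deg (w j))) \<Longrightarrow> (\<Sum>j=0..s. \<sigma> j * w j) \<in> sos_cone w s k"
  unfolding sos_cone_def by blast

lemma sos_coneE:
  assumes "p \<in> sos_cone w s k"
  obtains \<sigma> where "p = (\<Sum>j=0..s. \<sigma> j * w j)" "\<And>j. j \<in> {0..s} \<Longrightarrow> \<sigma> j \<in> sos (int k - half_deg (w j))"
  using assms unfolding sos_cone_def by blast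

lemma sos_cone_mono:
  assumes "p \<in> sos_cone w s k" "k \<le> l"
  shows "p \<in> sos_cone w s l"
  using assms(1)
proof (rule sos_coneE)
  fix \<sigma> assume p: "p = (\<Sum>j=0..s. \<sigma> j * w j)"
    and \<sigma>: "\<And>j. j \<in> {0..s} \<Longrightarrow> \<sigma> j \<in> sos (int k - half_deg (w j))"
  show ?thesis
    unfolding p using assms(2) by (intro sos_coneI sos_mono[OF \<sigma>]) simp_all
qed

lemma sos_cone_add:
  assumes "p \<in> sos_cone w s k" "q \<in> sos_cone w s k"
  shows "p + q \<in> sos_cone w s k"
proof -
  obtain \<sigma> where "p = (\<Sum>j=0..s. \<sigma> j * w j)"
    "\<And>j. j \<in> {0..s} \<Longrightarrow> \<sigma> j \<in> sos (int k - half_deg (w j))"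
    using assms(1) by (rule sos_coneE) (rule that)
  moreover obtain \<tau> where "q = (\<Sum>j=0..s. \<tau> j * w j)"
    "\<And>j. j \<in> {0..s} \<Longrightarrow> \<tau> j \<in> sos (int k - half_deg (w j))"
    using assms(2) by (rule sos_coneE) (rule that)
  moreover have "(\<Sum>j=0..s. \<sigma> j * w j) + (\<Sum>j=0..s. \<tau> j * w j) = (\<Sum>j=0..s. (\<sigma> j + \<tau> j) * w j)"
    by (simp add: sum.distrib distrib_right)
  ultimately show ?thesis by (auto intro!: sos_coneI sos_add)
qed

lemma sos_cone_square_mult:
  assumes "p \<in> sos_cone w s k" "b \<in> polys_upto e"
  shows "b\<^sup>2 * p \<in> sos_cone w s (k + e)"
proof -
  obtain \<sigma> where p: "p = (\<Sum>j=0..s. \<sigma> j * w j)"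
    and \<sigma>: "\<And>j. j \<in> {0..s} \<Longrightarrow> \<sigma> j \<in> sos (int k - half_deg (w j))"
    using assms(1) by (rule sos_coneE) (rule that)
  have "b\<^sup>2 * p = (\<Sum>j=0..s. (b\<^sup>2 * \<sigma> j) * w j)"
    by (simp add: p sum_distrib_left mult.assoc)
  moreover have "b\<^sup>2 * \<sigma> j \<in> sos (int (k + e) - half_deg (w j))" if "j \<in> {0..s}" for j
    using sos_square_mult[OF \<sigma>[OF that] assms(2)] by (simp add: algebra_simps)
  ultimately show ?thesis by (auto intro!: sos_coneI)
qed

lemma sos_cone_scale:
  assumes "p \<in> sos_cone w s k" "0 \<le> c"
  shows "const_poly c * p \<in> sos_cone w s k"
proof -
  have "const_poly c = (const_poly (sqrt c))\<^sup>2"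
    using assms by (simp flip: const_poly_power)
  then show ?thesis
    using sos_cone_square_mult[OF assms(1), of "const_poly (sqrt c)" 0]
    by (metis add_0_right exp_deg_0 order_refl polys_upto_single)
qed

lemma constraint_in_sos_cone:
  assumes "j \<in> {0..s}"
  shows "w j \<in> sos_cone w s (nat (half_deg (w j)))"
proof -
  have "w j = (\<Sum>i=0..s. (if i = j then 1 else 0) * w i)"
    using assms by (simp add: if_distrib[of "\<lambda>u. u * _"] cong: if_cong)
  also have "\<dots> \<in> sos_cone w s (nat (half_deg (w j)))"
    using half_deg_nonneg[of "w j"] by (intro sos_coneI) (auto simp: sos_nonneg_iff sum_squares_1)
  finally show ?thesis .
qed

lemma eval_sos_cone_nonneg:
  assumes "p \<in> sos_cone w s k" "\<And>j. j \<in> {0..s} \<Longrightarrow> 0 \<le> eval_poly (w j) x"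
  shows "0 \<le> eval_poly p x"
  using assms(1)
  by (rule sos_coneE) (auto intro!: sum_nonneg mult_nonneg_nonneg eval_sos_nonneg assms(2))

text \<open>Putinar's theorem for the union of the \<open>\<C>\<^sub>k\<close>, which is a quadratic module although no single
  \<open>\<C>\<^sub>k\<close> is one.\<close>

lemma positive_in_sos_cone:
  fixes w :: "nat \<Rightarrow> 'n::finite rpoly"
  assumes w0: "w 0 = 1" and ball: "ball_poly N \<in> sos_cone w s k0"
    and pos: "\<And>x. (\<And>j. j \<in> {0..s} \<Longrightarrow> 0 \<le> eval_poly (w j) x) \<Longrightarrow> 0 < eval_poly f x"
  shows "\<exists>k. f \<in> sos_cone w s k"
proof -
  let ?M = "\<Union>k. sos_cone w s k"
  have M: "quadratic_module ?M"
    unfolding quadratic_module_def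
  proof (intro conjI ballI allI)
    show "1 \<in> ?M" using constraint_in_sos_cone[of 0 s w] unfolding w0 by auto
  next
    fix a b assume "a \<in> ?M" "b \<in> ?M"
    then obtain k l where "a \<in> sos_cone w s k" "b \<in> sos_cone w s l" by blast
    then have "a + b \<in> sos_cone w s (max k l)"
      by (intro sos_cone_add) (auto elim: sos_cone_mono)
    then show "a + b \<in> ?M" by blast
  next
    fix a b :: "'n rpoly" assume "a \<in> ?M"
    then obtain k where "a \<in> sos_cone w s k" by blast
    moreover obtain e where "b \<in> polys_upto e" using polys_upto_exists by blast
    ultimately have "b\<^sup>2 * a \<in> sos_cone w s (k + e)" by (rule sos_cone_square_mult)
    then show "b\<^sup>2 * a \<in> ?M" by blast
  qed
  have "f \<in> ?M"
  proof (rule putinar_positivstellensatz[OF M archimedean_module_if_ball[OF M]])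
    show "ball_poly N \<in> ?M" using ball by blast
    show "0 < eval_poly f x" if x: "\<forall>q\<in>?M. 0 \<le> eval_poly q x" for x
    proof (rule pos)
      fix j assume "j \<in> {0..s}"
      then have "w j \<in> ?M" using constraint_in_sos_cone by blast
      then show "0 \<le> eval_poly (w j) x" using x by blast
    qed
  qed
  then show ?thesis by blast
qed

section \<open>The objective function\<close>

lemma open_emeasure_pos:
  fixes U :: "('a::euclidean_space) set"
  assumes "open U" "U \<noteq> {}"
  shows "0 < emeasure lborel U"
proof -
  obtain a r where "0 < r" "ball a r \<subseteq> U"
    using assms open_contains_ball by (metis ex_in_conv)
  have "emeasure lborel (ball a r) \<noteq> 0"
    using content_ball_pos[OF \<open>0 < r\<close>, of a] by (auto simp: measure_def)
  moreover have "emeasure lborel (ball a r) \<le> emeasure lborel U"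
    using \<open>ball a r \<subseteq> U\<close> assms by (intro emeasure_mono) auto
  ultimately show ?thesis by (metis le_zero_eq not_gr_zero)
qed

text \<open>Where a homogeneous \<open>g\<close> is negative, \<open>exp (- g)\<close> exceeds \<open>1\<close>; this set is open and invariant
  under dilation, so it is empty or has infinite volume.\<close>

lemma eval_nonneg_if_objective_finite:
  fixes g :: "'n::finite rpoly"
  assumes g: "g \<in> homog_polys d" and fin: "objective g < \<infinity>"
  shows "0 \<le> eval_poly g x"
proof (rule ccontr)
  assume x: "\<not> 0 \<le> eval_poly g x"
  define U where "U = {y. eval_poly g y < 0}"
  have "open U"
    unfolding U_def by (intro open_Collect_less continuous_on_eval_poly continuous_on_const)
  have "U \<noteq> {}" using x by (auto simp: U_def not_le)
  have borelU: "U \<in> sets borel" using \<open>open U\<close> by simp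
  have "(\<lambda>y. 2 *\<^sub>R y + 0) ` U \<subseteq> U"
    by (auto simp: U_def eval_homog_scaleR[OF g] mult_less_0_iff)
  then have "emeasure lebesgue ((\<lambda>y. 2 *\<^sub>R y + 0) ` U) \<le> emeasure lebesgue U"
    using borelU by (intro emeasure_mono) auto
  then have le: "ennreal (2 ^ CARD('n)) * emeasure lborel U \<le> emeasure lborel U"
    using borelU by (simp only: emeasure_lebesgue_affine) simp
  have "emeasure lborel U = (\<integral>\<^sup>+y. indicator U y \<partial>lborel)"
    using borelU by simp
  also have "\<dots> \<le> objective g"
    unfolding objective_def by (intro nn_integral_mono) (auto simp: U_def indicator_def)
  finally have "emeasure lborel U < \<infinity>" using fin by (rule le_less_trans)
  then obtain u where u: "emeasure lborel U = ennreal u" "0 \<le> u"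
    by (cases "emeasure lborel U") auto
  have "0 < u" using open_emeasure_pos[OF \<open>open U\<close> \<open>U \<noteq> {}\<close>] u by simp
  have "ennreal (2 ^ CARD('n) * u) \<le> ennreal u"
    using le u by (simp add: ennreal_mult)
  then have "2 ^ CARD('n) * u \<le> u" using u(2) by (simp add: ennreal_le_iff)
  moreover have "(1::real) < 2 ^ CARD('n)" by (rule one_less_power) (auto simp: card_gt_0_iff)
  ultimately show False using \<open>0 < u\<close> by (smt (verit) mult_less_cancel_right1)
qed

lemma finite_sublevel_volume_if_objective_finite:
  assumes "objective g < \<infinity>"
  shows "emeasure lborel {x. eval_poly g x \<le> 1} < \<infinity>"
proof -
  let ?L = "{x. eval_poly g x \<le> 1}"
  have L: "?L \<in> sets borel" by measurable
  have "ennreal (exp (- 1)) * emeasure lborel ?L = (\<integral>\<^sup>+x. ennreal (exp (- 1)) * indicator ?L x \<partial>lborel)"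
    using L by (simp add: nn_integral_cmult_indicator)
  also have "\<dots> \<le> objective g"
    unfolding objective_def by (intro nn_integral_mono) (auto simp: indicator_def intro!: ennreal_leI)
  finally have "ennreal (exp (- 1)) * emeasure lborel ?L < \<infinity>" using assms by (rule le_less_trans)
  then show ?thesis by (auto simp: ennreal_mult_less_top)
qed

text \<open>Lower semicontinuity of the objective, by Fatou's lemma.\<close>

lemma objective_le_limit:
  assumes p: "\<And>m. p m \<in> polys_upto D" and l: "l \<in> polys_upto D"
    and lim: "\<And>\<alpha>. (\<lambda>m. mcoeff (p m) \<alpha>) \<longlonglongrightarrow> mcoeff l \<alpha>"
    and obj: "(\<lambda>m. objective (p m)) \<longlonglongrightarrow> c"
  shows "objective l \<le> c"
proof -
  have "(\<lambda>m. ennreal (exp (- eval_poly (p m) x))) \<longlonglongrightarrow> ennreal (exp (- eval_poly l x))" for x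
    by (intro tendsto_ennrealI tendsto_exp tendsto_minus eval_poly_tendsto[OF p l lim])
  then have "liminf (\<lambda>m. ennreal (exp (- eval_poly (p m) x))) = ennreal (exp (- eval_poly l x))" for x
    by (intro lim_imp_Liminf) auto
  then have "objective l = (\<integral>\<^sup>+x. liminf (\<lambda>m. ennreal (exp (- eval_poly (p m) x))) \<partial>lborel)"
    by (simp add: objective_def)
  also have "\<dots> \<le> liminf (\<lambda>m. objective (p m))"
    unfolding objective_def by (rule nn_integral_liminf) measurable
  also have "\<dots> = c" using obj by (intro lim_imp_Liminf) auto
  finally show ?thesis .
qed

lemma objective_convex:
  assumes "0 \<le> t" "t \<le> 1"
  shows "objective (const_poly (1 - t) * g + const_poly t * h) \<le>
      ennreal (1 - t) * objective g + ennreal t * objective h"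
proof -
  have "exp (- eval_poly (const_poly (1 - t) * g + const_poly t * h) x) \<le>
      (1 - t) * exp (- eval_poly g x) + t * exp (- eval_poly h x)" for x
    using convex_onD[OF exp_convex, of t "- eval_poly g x" "- eval_poly h x"] assms
    by (simp add: algebra_simps)
  then have "objective (const_poly (1 - t) * g + const_poly t * h) \<le>
      (\<integral>\<^sup>+x. ennreal (1 - t) * ennreal (exp (- eval_poly g x)) + ennreal t * ennreal (exp (- eval_poly h x)) \<partial>lborel)"
    unfolding objective_def using assms
    by (intro nn_integral_mono) (simp add: ennreal_leI flip: ennreal_mult ennreal_plus)
  also have "\<dots> = ennreal (1 - t) * objective g + ennreal t * objective h"
    unfolding objective_def by (simp add: nn_integral_add nn_integral_cmult)
  finally show ?thesis .
qed

text \<open>Strict convexity: the defect in the midpoint inequality is the integral of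
  \<open>(exp (- g / 2) - exp (- h / 2))\<^sup>2\<close>.\<close>

lemma eq_if_midpoint_not_better:
  assumes g: "objective g = v" and h: "objective h = v" and v: "v < \<infinity>"
    and mid: "v \<le> objective (const_poly (1 / 2) * (g + h))"
  shows "g = h"
proof -
  let ?m = "const_poly (1 / 2) * (g + h)"
  define D where "D x = (exp (- eval_poly g x / 2) - exp (- eval_poly h x / 2))\<^sup>2" for x
  have D_meas [measurable]: "D \<in> borel_measurable borel" unfolding D_def by measurable
  have exp_half: "(exp (y / 2))\<^sup>2 = exp y" for y :: real
    by (simp flip: exp_double)
  have "exp (- eval_poly g x) + exp (- eval_poly h x) = D x + 2 * exp (- eval_poly ?m x)" for x
  proof -
    have "exp (- eval_poly g x / 2) * exp (- eval_poly h x / 2) = exp (- eval_poly ?m x)"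
      by (simp add: field_simps flip: exp_add)
    then show ?thesis
      using exp_half[of "- eval_poly g x"] exp_half[of "- eval_poly h x"]
      by (simp add: D_def power2_diff)
  qed
  then have "ennreal (exp (- eval_poly g x)) + ennreal (exp (- eval_poly h x)) =
      ennreal (D x) + 2 * ennreal (exp (- eval_poly ?m x))" for x
    by (simp add: D_def ennreal_mult flip: ennreal_plus ennreal_numeral ennreal_mult)
  then have "(\<integral>\<^sup>+x. ennreal (exp (- eval_poly g x)) + ennreal (exp (- eval_poly h x)) \<partial>lborel) =
      (\<integral>\<^sup>+x. ennreal (D x) + 2 * ennreal (exp (- eval_poly ?m x)) \<partial>lborel)" by simp
  then have "v + v = (\<integral>\<^sup>+x. ennreal (D x) \<partial>lborel) + 2 * objective ?m"
    using g h unfolding objective_def by (simp add: nn_integral_add nn_integral_cmult)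
  moreover have "2 * objective ?m \<ge> v + v"
    using add_mono[OF mid mid] by (simp add: mult_2)
  ultimately have "(\<integral>\<^sup>+x. ennreal (D x) \<partial>lborel) + (v + v) \<le> v + v"
    by (metis add_left_mono)
  then have le: "(v + v) + (\<integral>\<^sup>+x. ennreal (D x) \<partial>lborel) \<le> (v + v) + 0"
    by (simp only: add.commute add_0_right add_0_left)
  have "v + v \<noteq> \<infinity>" using v by (auto simp: ennreal_add_eq_top)
  then have "(\<integral>\<^sup>+x. ennreal (D x) \<partial>lborel) = 0"
    using le unfolding ennreal_add_left_cancel_le by simp
  then have "AE x in lborel. ennreal (D x) = 0"
    by (subst (asm) nn_integral_0_iff_AE) auto
  then have AE: "AE x in lborel. D x = 0"
    by (rule eventually_mono) (simp add: D_def)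
  define U where "U = {x. eval_poly g x \<noteq> eval_poly h x}"
  have "open U"
    unfolding U_def by (intro open_Collect_neq continuous_on_eval_poly)
  have "D x \<noteq> 0" if "x \<in> U" for x
    using that by (auto simp: U_def D_def)
  then have "AE x in lborel. x \<notin> U" using AE by (auto elim: eventually_mono)
  then have "emeasure lborel U = 0"
    using \<open>open U\<close> by (subst (asm) AE_iff_measurable[where N = U]) auto
  then have "U = {}" using open_emeasure_pos[OF \<open>open U\<close>] by auto
  then show ?thesis by (intro poly_eqI_eval) (auto simp: U_def)
qed

section \<open>A homogeneous polynomial with finite objective\<close>

lemma even_power_ge_square_minus_1:
  fixes x :: real
  assumes "even d" "0 < d"
  shows "x\<^sup>2 - 1 \<le> x ^ d"
proof (cases "1 \<le> \<bar>x\<bar>")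
  case True
  have "2 \<le> d" using assms by (auto elim!: evenE)
  then have "\<bar>x\<bar>\<^sup>2 \<le> \<bar>x\<bar> ^ d" using True by (intro power_increasing) auto
  then show ?thesis using assms(1) by (simp add: power_even_abs)
next
  case False
  then have "x\<^sup>2 \<le> 1" by (simp add: abs_square_le_1)
  moreover have "0 \<le> x ^ d" using assms by (simp add: zero_le_even_power)
  ultimately show ?thesis by linarith
qed

text \<open>The integrand is at most a multiple of \<open>1 / (1 + x\<^sup>2)\<close>.\<close>

lemma exp_neg_even_power_integral_finite:
  fixes c :: real
  assumes "even d" "0 < d" "0 < c"
  shows "(\<integral>\<^sup>+x. ennreal (exp (- (c * x ^ d))) \<partial>lborel) < \<infinity>"
proof -
  define A where "A = exp c / min 1 c"
  have "A > 0" using assms by (simp add: A_def)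
  define f where "f x = A * inverse (1 + x\<^sup>2)" for x :: real
  have f_meas [measurable]: "f \<in> borel_measurable borel" unfolding f_def by measurable
  have f_nonneg: "0 \<le> f x" for x using \<open>A > 0\<close> by (simp add: f_def)
  have bound: "exp (- (c * x ^ d)) \<le> f x" for x
  proof -
    have "exp (- (c * x ^ d)) \<le> exp (c - c * x\<^sup>2)"
      using mult_left_mono[OF even_power_ge_square_minus_1[OF assms(1,2), of x], of c] assms(3)
      by (simp add: algebra_simps)
    also have "\<dots> = exp c * inverse (exp (c * x\<^sup>2))" by (simp add: exp_diff divide_inverse)
    also have "\<dots> \<le> exp c * inverse (min 1 c * (1 + x\<^sup>2))"
    proof (intro mult_left_mono le_imp_inverse_le)
      have "min 1 c * (1 + x\<^sup>2) \<le> 1 + c * x\<^sup>2"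
        unfolding distrib_left by (intro add_mono mult_right_mono) auto
      also have "\<dots> \<le> exp (c * x\<^sup>2)" by (rule exp_ge_add_one_self)
      finally show "min 1 c * (1 + x\<^sup>2) \<le> exp (c * x\<^sup>2)" .
      show "0 < min 1 c * (1 + x\<^sup>2)" using assms(3) by (intro mult_pos_pos add_pos_nonneg) auto
    qed simp
    also have "\<dots> = f x" by (simp add: f_def A_def divide_inverse)
    finally show ?thesis .
  qed
  have half: "(\<integral>\<^sup>+x. ennreal (f x) * indicator {0..} x \<partial>lborel) = ennreal (A * (pi / 2))"
  proof -
    have "(\<integral>\<^sup>+x. ennreal (f x) * indicator {0..} x \<partial>lborel) = ennreal (A * (pi / 2) - A * arctan 0)"
    proof (rule nn_integral_FTC_atLeast[where F = "\<lambda>x. A * arctan x"])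
      show "((\<lambda>x. A * arctan x) has_real_derivative f x) (at x)" for x
        unfolding f_def by (intro DERIV_cmult DERIV_arctan)
      show "((\<lambda>x. A * arctan x) \<longlongrightarrow> A * (pi / 2)) at_top"
        by (intro tendsto_mult tendsto_const tendsto_arctan_at_top)
    qed (auto simp: f_nonneg)
    then show ?thesis by simp
  qed
  have "(\<integral>\<^sup>+x. ennreal (exp (- (c * x ^ d))) \<partial>lborel) \<le>
      (\<integral>\<^sup>+x. ennreal (f x) * indicator {0..} x + ennreal (f x) * indicator {..0} x \<partial>lborel)"
    by (intro nn_integral_mono) (auto simp: indicator_def intro!: ennreal_leI bound add_increasing2)
  also have "\<dots> = (\<integral>\<^sup>+x. ennreal (f x) * indicator {0..} x \<partial>lborel) + (\<integral>\<^sup>+x. ennreal (f x) * indicator {..0} x \<partial>lborel)"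
    by (rule nn_integral_add) measurable
  also have "(\<integral>\<^sup>+x. ennreal (f x) * indicator {..0} x \<partial>lborel) =
      (\<integral>\<^sup>+x. ennreal (f x) * indicator {0..} x \<partial>lborel)"
  proof -
    have "(\<integral>\<^sup>+x. ennreal (f x) * indicator {..0} x \<partial>lborel) =
        (\<integral>\<^sup>+x. ennreal (f (0 + - 1 * x)) * indicator {..0} (0 + - 1 * x) \<partial>lborel)"
      by (subst nn_integral_real_affine[where t = 0 and c = "- 1"]) auto
    also have "\<dots> = (\<integral>\<^sup>+x. ennreal (f x) * indicator {0..} x \<partial>lborel)"
      by (intro nn_integral_cong) (simp add: f_def indicator_def)
    finally show ?thesis .
  qed
  finally show ?thesis unfolding half by (rule le_less_trans) (simp flip: ennreal_plus)
qed

lemma power_sum_finite_objective: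
  assumes "even d" "0 < d" "0 < c"
  shows "\<exists>g :: 'n::finite rpoly. g \<in> homog_polys d \<and> objective g < \<infinity> \<and>
      (\<forall>x. eval_poly g x = c * (\<Sum>i\<in>UNIV. (x $ i) ^ d))"
proof -
  define g :: "'n rpoly" where "g = (\<Sum>i\<in>UNIV. Poly_Mapping.single (Poly_Mapping.single i d) c)"
  have eval: "eval_poly g x = c * (\<Sum>i\<in>UNIV. (x $ i) ^ d)" for x
    by (simp add: g_def sum_distrib_left)
  have "g \<in> homog_polys d"
    unfolding homog_polys_def
  proof (clarify, rule ccontr)
    fix \<alpha> assume \<alpha>: "mcoeff g \<alpha> \<noteq> 0" "exp_deg \<alpha> \<noteq> d"
    then have "Poly_Mapping.single i d \<noteq> \<alpha>" for i by auto
    then have "mcoeff g \<alpha> = 0" by (simp add: g_def lookup_sum lookup_single when_def)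
    then show False using \<alpha> by simp
  qed
  moreover have "objective g < \<infinity>"
  proof -
    have Basis: "(Basis :: (real ^ 'n) set) = range (\<lambda>i. axis i 1)" by (auto simp: Basis_vec_def)
    have inj: "inj (\<lambda>i :: 'n. axis i (1 :: real))" by (auto simp: inj_def axis_eq_axis)
    have "objective g = (\<integral>\<^sup>+x. (\<Prod>b\<in>(Basis :: (real ^ 'n) set). ennreal (exp (- (c * (x \<bullet> b) ^ d)))) \<partial>lborel)"
      unfolding objective_def
    proof (intro nn_integral_cong)
      fix x :: "real ^ 'n"
      have "exp (- eval_poly g x) = (\<Prod>i\<in>UNIV. exp (- (c * (x $ i) ^ d)))"
        by (simp add: eval sum_distrib_left flip: exp_sum sum_negf)
      also have "\<dots> = (\<Prod>b\<in>Basis. exp (- (c * (x \<bullet> b) ^ d)))"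
        unfolding Basis by (subst prod.reindex[OF inj]) (simp add: inner_axis)
      finally show "ennreal (exp (- eval_poly g x)) = (\<Prod>b\<in>Basis. ennreal (exp (- (c * (x \<bullet> b) ^ d))))"
        by (simp add: prod_ennreal)
    qed
    also have "\<dots> = (\<Prod>b\<in>(Basis :: (real ^ 'n) set). \<integral>\<^sup>+t. ennreal (exp (- (c * t ^ d))) \<partial>lborel)"
      by (rule nn_integral_lborel_prod) auto
    also have "\<dots> < \<infinity>"
      using exp_neg_even_power_integral_finite[OF assms] by (simp add: power_less_top_ennreal)
    finally show ?thesis .
  qed
  ultimately show ?thesis using eval by blast
qed

section \<open>Existence and uniqueness of optimal solutions\<close>

lemma homog_polys_add: "g \<in> homog_polys d \<Longrightarrow> h \<in> homog_polys d \<Longrightarrow> g + h \<in> homog_polys d"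
  unfolding homog_polys_def by (auto simp: lookup_add) (metis add.right_neutral)+

lemma homog_polys_scale: "g \<in> homog_polys d \<Longrightarrow> const_poly c * g \<in> homog_polys d"
  by (auto simp: homog_polys_def)

lemma homog_polys_closed:
  assumes "\<And>m. p m \<in> homog_polys d" and lim: "\<And>\<alpha>. (\<lambda>m. mcoeff (p m) \<alpha>) \<longlonglongrightarrow> mcoeff l \<alpha>"
  shows "l \<in> homog_polys d"
proof -
  have "mcoeff l \<alpha> = 0" if "exp_deg \<alpha> \<noteq> d" for \<alpha>
  proof -
    have "mcoeff (p m) \<alpha> = 0" for m using assms(1)[of m] that by (auto simp: homog_polys_def)
    then show ?thesis using lim[of \<alpha>] by (simp add: LIMSEQ_const_iff)
  qed
  then show ?thesis by (auto simp: homog_polys_def)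
qed

lemma feasible_iff: "g \<in> feasible d K \<longleftrightarrow> g \<in> homog_polys d \<and> (\<forall>x\<in>K. eval_poly g x \<le> 1)"
proof -
  have "1 - g \<in> polys_upto d" if "g \<in> homog_polys d"
  proof -
    have "exp_deg \<alpha> \<le> d" if "mcoeff (1 - g) \<alpha> \<noteq> 0" for \<alpha>
      using that \<open>g \<in> homog_polys d\<close>
      by (cases "\<alpha> = 0") (auto simp: lookup_minus lookup_one when_def homog_polys_def)
    then show ?thesis by (auto simp: polys_upto_def)
  qed
  then show ?thesis by (auto simp: feasible_def nonneg_cone_def)
qed

text \<open>On the feasible set, finiteness of the objective confines \<open>g\<close> to values in \<open>[0, 1]\<close> on
  \<open>K\<close>, which bounds its coefficients.\<close>

lemma feasible_convergent_subsequence: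
  fixes K :: "(real ^ 'n::finite) set"
  assumes int: "interior K \<noteq> {}" and p: "\<And>m. p m \<in> feasible d K" "\<And>m. objective (p m) < \<infinity>"
  shows "\<exists>(r :: nat \<Rightarrow> nat) l. strict_mono r \<and> l \<in> feasible d K \<and>
      (\<forall>\<alpha>. (\<lambda>m. mcoeff (p (r m)) \<alpha>) \<longlonglongrightarrow> mcoeff l \<alpha>)"
proof -
  have homog: "p m \<in> homog_polys d" and le1: "x \<in> K \<Longrightarrow> eval_poly (p m) x \<le> 1" for m x
    using p(1)[of m] by (auto simp: feasible_iff)
  have "\<exists>(r :: nat \<Rightarrow> nat) q. strict_mono r \<and> (\<forall>j. q j \<in> polys_upto d) \<and>
      (\<forall>j\<in>UNIV :: unit set. \<forall>\<alpha>. (\<lambda>m. mcoeff (p (r m)) \<alpha>) \<longlonglongrightarrow> mcoeff (q j) \<alpha>)"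
  proof (rule pointwise_bounded_polys_subsequence[OF open_interior int, where p = "\<lambda>m _. p m"])
    show "p m \<in> polys_upto d" for m using homog by (rule homog_polys_upto)
    show "\<exists>C. \<forall>m. \<bar>eval_poly (p m) x\<bar> \<le> C" if "x \<in> interior K" for x
      using that interior_subset[of K] le1 eval_nonneg_if_objective_finite[OF homog p(2)]
      by (intro exI[of _ 1]) (auto simp: abs_le_iff intro: order_trans[of _ 0])
  qed simp
  then obtain r :: "nat \<Rightarrow> nat" and l where r: "strict_mono r" and l: "l \<in> polys_upto d"
    and lim: "\<And>\<alpha>. (\<lambda>m. mcoeff (p (r m)) \<alpha>) \<longlonglongrightarrow> mcoeff l \<alpha>"
    by blast
  have "l \<in> homog_polys d" by (rule homog_polys_closed[OF homog lim])
  moreover have "eval_poly l x \<le> 1" if "x \<in> K" for x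
    by (rule LIMSEQ_le_const2[OF eval_poly_tendsto[OF homog_polys_upto[OF homog] l lim]])
      (use that le1 in blast)
  ultimately show ?thesis using r lim by (auto simp: feasible_iff)
qed

lemma opt_value_le: "g \<in> S \<Longrightarrow> opt_value S \<le> objective g"
  unfolding opt_value_def by (rule INF_lower)

lemma unique_optimal_iff:
  "unique_optimal S g \<longleftrightarrow> g \<in> S \<and> objective g = opt_value S \<and>
     (\<forall>h\<in>S. objective h = opt_value S \<longrightarrow> h = g)"
proof -
  have "is_arg_min objective (\<lambda>h. h \<in> S) g \<longleftrightarrow> g \<in> S \<and> objective g = opt_value S" for g
  proof
    assume "is_arg_min objective (\<lambda>h. h \<in> S) g"
    then have g: "g \<in> S" "\<And>h. h \<in> S \<Longrightarrow> objective g \<le> objective h"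
      by (auto simp: is_arg_min_linorder)
    then have "objective g \<le> opt_value S" unfolding opt_value_def by (intro INF_greatest)
    then show "g \<in> S \<and> objective g = opt_value S" using g(1) opt_value_le by (auto intro: antisym)
  next
    assume "g \<in> S \<and> objective g = opt_value S"
    then show "is_arg_min objective (\<lambda>h. h \<in> S) g"
      by (auto simp: is_arg_min_linorder intro: opt_value_le)
  qed
  then show ?thesis unfolding unique_optimal_def by auto
qed

text \<open>Compactness of minimizing sequences, lower semicontinuity and strict convexity combined, in a
  form that covers the problem on \<open>K\<close> and all of its relaxations.\<close>

lemma unique_optimal_exists:
  fixes K :: "(real ^ 'n::finite) set"
  assumes int: "interior K \<noteq> {}" and sub: "S \<subseteq> feasible d K"
    and mid: "\<And>g h. g \<in> S \<Longrightarrow> h \<in> S \<Longrightarrow> const_poly (1 / 2) * (g + h) \<in> S"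
    and closed: "\<And>p l. (\<And>m. p m \<in> S) \<Longrightarrow> l \<in> feasible d K \<Longrightarrow>
      (\<And>\<alpha>. (\<lambda>m. mcoeff (p m) \<alpha>) \<longlonglongrightarrow> mcoeff l \<alpha>) \<Longrightarrow> l \<in> S"
    and g0: "g0 \<in> S" "objective g0 < \<infinity>"
  shows "\<exists>g\<in>finite_vol_homog d. unique_optimal S g"
proof -
  have fin: "opt_value S < \<infinity>" using opt_value_le[OF g0(1)] g0(2) by (rule le_less_trans)
  have "objective ` S \<noteq> {}" using g0(1) by blast
  then obtain u where "\<forall>m. u m \<in> objective ` S" and u: "u \<longlonglongrightarrow> opt_value S"
    using Inf_as_limit[of "objective ` S"] unfolding opt_value_def by blast
  then have "\<forall>m. \<exists>p. p \<in> S \<and> u m = objective p" by blast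
  then obtain p where p: "\<And>m. p m \<in> S" "\<And>m. u m = objective (p m)" by metis
  obtain N where N: "\<And>m. N \<le> m \<Longrightarrow> u m < \<infinity>"
    using order_tendstoD(2)[OF u fin] by (auto simp: eventually_sequentially)
  have fin_p: "objective (p (m + N)) < \<infinity>" for m using N[of "m + N"] by (simp add: p(2))
  have feas: "p m \<in> feasible d K" for m using p(1) sub by blast
  obtain r :: "nat \<Rightarrow> nat" and l where r: "strict_mono r" and l: "l \<in> feasible d K"
    and lim: "\<And>\<alpha>. (\<lambda>m. mcoeff (p (r m + N)) \<alpha>) \<longlonglongrightarrow> mcoeff l \<alpha>"
    using feasible_convergent_subsequence[OF int, of "\<lambda>m. p (m + N)", OF feas fin_p] by blast
  have "l \<in> S" by (rule closed[OF p(1) l lim])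
  have "objective l \<le> opt_value S"
  proof (rule objective_le_limit[OF _ _ lim])
    show "p (r m + N) \<in> polys_upto d" for m using feas by (auto simp: feasible_iff intro: homog_polys_upto)
    show "l \<in> polys_upto d" using l by (auto simp: feasible_iff intro: homog_polys_upto)
    have "(\<lambda>m. u (m + N)) \<longlonglongrightarrow> opt_value S" using u by (rule LIMSEQ_ignore_initial_segment)
    from LIMSEQ_subseq_LIMSEQ[OF this r] show "(\<lambda>m. objective (p (r m + N))) \<longlonglongrightarrow> opt_value S"
      by (simp add: o_def p(2))
  qed
  then have opt: "objective l = opt_value S" using opt_value_le[OF \<open>l \<in> S\<close>] by (rule antisym)
  have "h = l" if "h \<in> S" "objective h = opt_value S" for h
    by (rule eq_if_midpoint_not_better[OF that(2) opt fin opt_value_le[OF mid[OF that(1) \<open>l \<in> S\<close>]]])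
  then have "unique_optimal S l" using \<open>l \<in> S\<close> opt unfolding unique_optimal_iff by blast
  moreover have "l \<in> finite_vol_homog d"
    using l finite_sublevel_volume_if_objective_finite[of l] opt fin
    by (auto simp: finite_vol_homog_def feasible_iff)
  ultimately show ?thesis by blast
qed

section \<open>Convergence of the relaxations\<close>

lemma feasible_relax_iff:
  "g \<in> feasible_relax d w s k \<longleftrightarrow> g \<in> homog_polys d \<and> 1 - g \<in> sos_cone w s k"
  unfolding feasible_relax_def polys_upto_def homog_polys_def by (auto simp: nat_neq_iff)
    (metis le_neq_implies_less)+

lemma feasible_relax_mono: "k \<le> l \<Longrightarrow> feasible_relax d w s k \<subseteq> feasible_relax d w s l"
  by (auto simp: feasible_relax_iff intro: sos_cone_mono)

lemma feasible_relax_subset: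
  assumes "\<And>j x. j \<in> {0..s} \<Longrightarrow> x \<in> K \<Longrightarrow> 0 \<le> eval_poly (w j) x"
  shows "feasible_relax d w s k \<subseteq> feasible d K"
proof
  fix g assume g: "g \<in> feasible_relax d w s k"
  have "0 \<le> eval_poly (1 - g) x" if "x \<in> K" for x
    using g assms that by (intro eval_sos_cone_nonneg[of "1 - g" w s k]) (auto simp: feasible_relax_iff)
  then show "g \<in> feasible d K" using g by (auto simp: feasible_iff feasible_relax_iff)
qed

lemma tendsto_if_subsequences:
  fixes x :: "nat \<Rightarrow> 'a::metric_space"
  assumes "\<And>f :: nat \<Rightarrow> nat. strict_mono f \<Longrightarrow> \<exists>r :: nat \<Rightarrow> nat. strict_mono r \<and> (\<lambda>m. x (f (r m))) \<longlonglongrightarrow> l"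
  shows "x \<longlonglongrightarrow> l"
proof (rule ccontr)
  assume "\<not> x \<longlonglongrightarrow> l"
  then obtain e where "e > 0" and e: "\<And>N. \<exists>n\<ge>N. \<not> dist (x n) l < e"
    unfolding lim_sequentially by blast
  then have "infinite {n. \<not> dist (x n) l < e}"
    unfolding infinite_nat_iff_unbounded_le by auto
  then obtain f :: "nat \<Rightarrow> nat" where f: "strict_mono f" "\<And>n. \<not> dist (x (f n)) l < e"
    using infinite_enumerate by blast
  obtain r :: "nat \<Rightarrow> nat" where "(\<lambda>m. x (f (r m))) \<longlonglongrightarrow> l" using assms[OF f(1)] by blast
  then obtain m where "dist (x (f (r m))) l < e"
    using \<open>e > 0\<close> unfolding lim_sequentially by blast
  then show False using f(2) by blast
qed

theorem theorem5p3:
  fixes w :: "nat \<Rightarrow> 'n::finite rpoly" and s d :: nat and K :: "(real ^ 'n) set"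
  assumes "d > 0" and "even d"
    and "w 0 = 1"
    and "K = {x. \<forall>j\<in>{1..s}. 0 \<le> eval_poly (w j) x}"
    and "compact K" and "interior K \<noteq> {}"
    and "\<exists>M>0. \<exists>k. ball_poly M \<in> sos_cone w s k"
  shows "((\<lambda>k. opt_value (feasible_relax d w s k)) \<longlonglongrightarrow> opt_value (feasible d K))
    \<and> (\<exists>k0. \<forall>k\<ge>k0. \<exists>g\<in>finite_vol_homog d. unique_optimal (feasible_relax d w s k) g)
    \<and> (\<exists>gopt\<in>finite_vol_homog d. unique_optimal (feasible d K) gopt
        \<and> (\<forall>k0 g. (\<forall>k\<ge>k0. g k \<in> finite_vol_homog d
                            \<and> unique_optimal (feasible_relax d w s k) (g k))
              \<longrightarrow> (\<forall>\<alpha>. (\<lambda>k. mcoeff (g k) \<alpha>) \<longlonglongrightarrow> mcoeff gopt \<alpha>)))"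
proof -
  let ?R = "feasible_relax d w s" and ?\<rho> = "opt_value (feasible d K)"
  have K: "K = {x. \<forall>j\<in>{0..s}. 0 \<le> eval_poly (w j) x}"
  proof -
    have "{0..s} = insert 0 {1..s}" by auto
    then show ?thesis using assms(3,4) by simp
  qed
  have int: "interior {x. \<forall>j\<in>{0..s}. 0 \<le> eval_poly (w j) x} \<noteq> {}"
    using assms(6) unfolding K .
  obtain N kb where ball: "ball_poly N \<in> sos_cone w s kb" using assms(7) by blast
  have R_sub: "?R k \<subseteq> feasible d K" for k
    by (rule feasible_relax_subset) (auto simp: K)
  have strict: "\<exists>k. h \<in> ?R k" if h: "h \<in> homog_polys d" "\<And>x. x \<in> K \<Longrightarrow> eval_poly h x < 1" for h
  proof -
    have "\<exists>k. 1 - h \<in> sos_cone w s k"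
      by (rule positive_in_sos_cone[OF assms(3) ball]) (use h(2) in \<open>auto simp: K\<close>)
    then show ?thesis using h(1) by (simp add: feasible_relax_iff)
  qed

  obtain g0 :: "'n rpoly" where g0: "g0 \<in> homog_polys d" "objective g0 < \<infinity>"
    "\<And>x. x \<in> K \<Longrightarrow> eval_poly g0 x < 1"
  proof -
    have "compact ((\<lambda>x. \<Sum>i\<in>UNIV. (x $ i) ^ d) ` K)"
      by (intro compact_continuous_image assms(5) continuous_intros)
    then obtain B where B: "\<And>x. x \<in> K \<Longrightarrow> (\<Sum>i\<in>UNIV. (x $ i) ^ d) \<le> B" "0 < B"
      using compact_imp_bounded[THEN bounded_pos[THEN iffD1]] by (fastforce simp: abs_le_iff)
    define c where "c = 1 / (2 * B)"
    have "0 < c" using B(2) by (simp add: c_def)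
    obtain g0 :: "'n rpoly" where g0: "g0 \<in> homog_polys d" "objective g0 < \<infinity>"
      "\<And>x. eval_poly g0 x = c * (\<Sum>i\<in>UNIV. (x $ i) ^ d)"
      using power_sum_finite_objective[OF assms(2,1) \<open>0 < c\<close>] by blast
    have "eval_poly g0 x < 1" if "x \<in> K" for x
    proof -
      have "eval_poly g0 x \<le> c * B"
        unfolding g0(3) using B(1)[OF that] \<open>0 < c\<close> by (intro mult_left_mono) auto
      also have "\<dots> < 1" using B(2) by (simp add: c_def)
      finally show ?thesis .
    qed
    with g0 that show thesis by blast
  qed
  obtain kf where kf: "g0 \<in> ?R kf" using strict[OF g0(1,3)] by blast
  have g0_R: "g0 \<in> ?R k" if "kf \<le> k" for k
    using kf feasible_relax_mono[OF that] by blast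
  have g0_F: "g0 \<in> feasible d K" using kf R_sub by blast

  have unique_R: "\<exists>g\<in>finite_vol_homog d. unique_optimal (?R k) g" if "kf \<le> k" for k
  proof (rule unique_optimal_exists[OF assms(6) R_sub _ _ g0_R[OF that] g0(2)])
    fix g h assume gh: "g \<in> ?R k" "h \<in> ?R k"
    have "const_poly (1 / 2) * ((1 - g) + (1 - h)) \<in> sos_cone w s k"
      using gh by (intro sos_cone_scale sos_cone_add) (auto simp: feasible_relax_iff)
    also have "const_poly (1 / 2) * ((1 - g) + (1 - h)) = 1 - const_poly (1 / 2) * (g + h)"
      by (rule poly_eqI_eval) (simp add: field_simps)
    finally show "const_poly (1 / 2) * (g + h) \<in> ?R k"
      using gh by (auto simp: feasible_relax_iff intro: homog_polys_scale homog_polys_add)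
  next
    fix p l assume p: "\<And>m. p m \<in> ?R k" and l: "l \<in> feasible d K"
      and lim: "\<And>\<alpha>. (\<lambda>m. mcoeff (p m) \<alpha>) \<longlonglongrightarrow> mcoeff l \<alpha>"
    have upto: "1 - h \<in> polys_upto d" if "h \<in> feasible d K" for h
      using that by (simp add: feasible_def nonneg_cone_def)
    have "1 - l \<in> sos_cone w s k"
    proof (rule sos_cone_closed[OF int])
      show "1 - p m \<in> sos_cone w s k" for m using p[of m] by (simp add: feasible_relax_iff)
      show "1 - p m \<in> polys_upto d" for m using p[of m] R_sub by (intro upto) blast
      show "1 - l \<in> polys_upto d" using l by (rule upto)
      show "(\<lambda>m. mcoeff (1 - p m) \<alpha>) \<longlonglongrightarrow> mcoeff (1 - l) \<alpha>" for \<alpha>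
        unfolding lookup_minus by (intro tendsto_diff tendsto_const lim)
    qed
    then show "l \<in> ?R k" using l by (simp add: feasible_relax_iff feasible_iff)
  qed

  have "\<exists>g\<in>finite_vol_homog d. unique_optimal (feasible d K) g"
  proof (rule unique_optimal_exists[OF assms(6) subset_refl _ _ g0_F g0(2)])
    fix g h assume gh: "g \<in> feasible d K" "h \<in> feasible d K"
    have "eval_poly (const_poly (1 / 2) * (g + h)) x \<le> 1" if "x \<in> K" for x
    proof -
      have "eval_poly g x \<le> 1" "eval_poly h x \<le> 1" using gh that by (simp_all add: feasible_iff)
      then show ?thesis by simp
    qed
    then show "const_poly (1 / 2) * (g + h) \<in> feasible d K"
      using gh by (auto simp: feasible_iff intro: homog_polys_scale homog_polys_add)
  qed
  then obtain gopt where gopt: "gopt \<in> finite_vol_homog d" "unique_optimal (feasible d K) gopt" by blast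
  have gopt_F: "gopt \<in> feasible d K" and gopt_val: "objective gopt = ?\<rho>"
    and gopt_unique: "\<And>h. h \<in> feasible d K \<Longrightarrow> objective h = ?\<rho> \<Longrightarrow> h = gopt"
    using gopt(2) by (auto simp: unique_optimal_iff)
  have \<rho>_fin: "?\<rho> < \<infinity>" using opt_value_le[OF g0_F] g0(2) by (rule le_less_trans)
  have \<rho>_le: "?\<rho> \<le> opt_value (?R k)" for k
    unfolding opt_value_def by (rule INF_superset_mono[OF R_sub]) simp

  have lim_\<rho>: "(\<lambda>k. opt_value (?R k)) \<longlonglongrightarrow> ?\<rho>"
  proof -
    have "decseq (\<lambda>k. opt_value (?R k))"
      unfolding decseq_def opt_value_def by (intro allI impI INF_superset_mono feasible_relax_mono) auto
    then have lim: "(\<lambda>k. opt_value (?R k)) \<longlonglongrightarrow> (INF k. opt_value (?R k))" by (rule LIMSEQ_INF)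
    obtain a b where a: "?\<rho> = ennreal a" "0 \<le> a" and b: "objective g0 = ennreal b" "0 \<le> b"
      using \<rho>_fin g0(2) by (cases ?\<rho>; cases "objective g0") auto
    have below: "(INF k. opt_value (?R k)) \<le> ennreal ((1 - t) * a + t * b)" if t: "0 < t" "t < 1" for t
    proof -
      \<comment> \<open>\<open>gopt\<close> may touch the level \<open>1\<close> on \<open>K\<close>; moving towards \<open>g0\<close> gives the strict inequality that
        Putinar's theorem needs\<close>
      let ?h = "const_poly (1 - t) * gopt + const_poly t * g0"
      have "?h \<in> homog_polys d"
        using gopt_F g0(1) by (auto simp: feasible_iff intro: homog_polys_add homog_polys_scale)
      moreover have "eval_poly ?h x < 1" if "x \<in> K" for x
      proof -
        have "(1 - t) * eval_poly gopt x + t * eval_poly g0 x < (1 - t) * 1 + t * 1"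
          using t gopt_F g0(3)[OF that] that
          by (intro add_le_less_mono mult_left_mono mult_strict_left_mono) (auto simp: feasible_iff)
        then show ?thesis by simp
      qed
      ultimately obtain k where "?h \<in> ?R k" using strict by blast
      then have "(INF k. opt_value (?R k)) \<le> objective ?h"
        by (intro INF_lower2[of k] opt_value_le) auto
      also have "\<dots> \<le> ennreal (1 - t) * ennreal a + ennreal t * ennreal b"
        using objective_convex[of t gopt g0] t by (simp add: gopt_val a b)
      also have "\<dots> = ennreal ((1 - t) * a + t * b)"
        using t a(2) b(2) by (simp flip: ennreal_mult ennreal_plus)
      finally show ?thesis .
    qed
    have "(INF k. opt_value (?R k)) \<le> ennreal a"
    proof (rule tendsto_lowerbound[of "\<lambda>t. ennreal ((1 - t) * a + t * b)" _ "at_right 0"])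
      have "((\<lambda>t. (1 - t) * a + t * b) \<longlongrightarrow> (1 - 0) * a + 0 * b) (at_right 0)"
        by (intro tendsto_intros)
      then show "((\<lambda>t. ennreal ((1 - t) * a + t * b)) \<longlongrightarrow> ennreal a) (at_right 0)"
        by (intro tendsto_ennrealI) simp
      show "\<forall>\<^sub>F t in at_right 0. (INF k. opt_value (?R k)) \<le> ennreal ((1 - t) * a + t * b)"
        unfolding eventually_at_right_field using below by (intro exI[of _ 1]) auto
    qed simp
    then have "(INF k. opt_value (?R k)) = ?\<rho>"
      using \<rho>_le by (intro antisym INF_greatest) (simp_all add: a)
    then show ?thesis using lim by simp
  qed

  have "(\<lambda>k. mcoeff (g k) \<alpha>) \<longlonglongrightarrow> mcoeff gopt \<alpha>"
    if g: "\<And>k. k0 \<le> k \<Longrightarrow> unique_optimal (?R k) (g k)" for k0 g \<alpha>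
  proof (rule LIMSEQ_offset[where k = "max k0 kf"], rule tendsto_if_subsequences)
    let ?n = "max k0 kf"
    fix f :: "nat \<Rightarrow> nat" assume f: "strict_mono f"
    define p where "p m = g (f m + ?n)" for m
    have opt: "p m \<in> ?R (f m + ?n)" "objective (p m) = opt_value (?R (f m + ?n))" for m
      using g[of "f m + ?n"] by (auto simp: p_def unique_optimal_iff)
    have p_F: "p m \<in> feasible d K" for m using opt(1) R_sub by blast
    have p_fin: "objective (p m) < \<infinity>" for m
      unfolding opt(2) by (rule le_less_trans[OF opt_value_le[OF g0_R] g0(2)]) simp
    obtain r :: "nat \<Rightarrow> nat" and l where r: "strict_mono r" and l: "l \<in> feasible d K"
      and lim: "\<And>\<alpha>. (\<lambda>m. mcoeff (p (r m)) \<alpha>) \<longlonglongrightarrow> mcoeff l \<alpha>"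
      using feasible_convergent_subsequence[OF assms(6), of p, OF p_F p_fin] by blast
    have upto: "h \<in> polys_upto d" if "h \<in> feasible d K" for h
      using that by (auto simp: feasible_iff intro: homog_polys_upto)
    have "objective l \<le> ?\<rho>"
    proof (rule objective_le_limit[OF upto[OF p_F] upto[OF l] lim])
      have "(\<lambda>k. opt_value (?R (k + ?n))) \<longlonglongrightarrow> ?\<rho>" using lim_\<rho> by (rule LIMSEQ_ignore_initial_segment)
      from LIMSEQ_subseq_LIMSEQ[OF this strict_mono_o[OF f r]]
      show "(\<lambda>m. objective (p (r m))) \<longlonglongrightarrow> ?\<rho>" by (simp add: o_def opt(2))
    qed
    then have "l = gopt" using opt_value_le[OF l] by (intro gopt_unique l antisym)
    then show "\<exists>r :: nat \<Rightarrow> nat. strict_mono r \<and> (\<lambda>m. mcoeff (g (f (r m) + ?n)) \<alpha>) \<longlonglongrightarrow> mcoeff gopt \<alpha>"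
      using r lim by (auto simp: p_def)
  qed
  then show ?thesis using lim_\<rho> unique_R gopt by blast
qed

end
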